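(* For every integer $M\ge2$, the received bit energy at zero spectral efficiency and the wideband slope achieved by $M$-ary PSK signaling with hard-decision detection over the noncoherent Rician fading channel with Rician factor $\mathsf{K}=|d|^2/\gamma^2$ (defined in the context) are $$\left.\frac{E_b^r}{N_0}\right|_{\mathsf{C}=0} = \begin{cases}\dfrac{\pi}{2}\left(1+\dfrac{1}{\mathsf{K}}\right)\log_e 2 & M=2,\\[4pt] \dfrac{4\pi}{M^2\sin^2\frac{\pi}{M}}\left(1+\dfrac1{\mathsf{K}}\right)\log_e2 & M\ge3,\end{cases}$$ and $$S_0=\begin{cases}\dfrac{3}{\pi-1+\frac{3\pi}{2\mathsf{K}}} & M=2,\\[4pt] 0 & M=3,\\[4pt] \dfrac{6}{\pi-1+\frac{3\pi}{\mathsf{K}}} & M=4,\\[4pt] \dfrac{\frac{M^4}{8\pi^2}\sin^4\frac{\pi}{M}}{-\psi(M)+\frac{1}{2\pi\mathsf{K}}M^2\sin^2\frac{\pi}{M}} & M\ge5,\end{cases}$$ respectively, where $$\psi(M) = \frac{M^2}{16\pi^2}\left((2-\pi)\sin^2\frac{2\pi}{M} + (M^2-4\pi)\sin^4\frac{\pi}{M} - 2M\sin^2\frac{\pi}{M}\sin\frac{2\pi}{M}\right).$$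
   Context: Noncoherent Rician fading channel with $M$-ary PSK and hard decisions: the input is $x\in\{0,\dots,M-1\}$; when $x=m$ the transmitted signal is $s_m=\sqrt{\mathcal{E}}\,e^{j2\pi m/M}$, and the received signal is $r=hs_m+n$, where $n$ is zero-mean circularly symmetric complex Gaussian with $E\{|n|^2\}=N_0>0$, and the fading coefficient $h$ (i.i.d. from symbol to symbol, independent of the noise and input, unknown to both transmitter and receiver) is proper complex Gaussian with mean $E\{h\}=d\ne0$ and variance $E\{|h-d|^2\}=\gamma^2>0$. The Rician factor is $\mathsf{K}=|d|^2/\gamma^2$. The conditional density of $r$ is $f_{r|s_m}(r|s_m)=\frac{1}{\pi(\gamma^2|s_m|^2+N_0)}e^{-|r-ds_m|^2/(\gamma^2|s_m|^2+N_0)}$. Set $\mathrm{SNR}=\mathcal{E}/N_0$. The maximum likelihood detector outputs $y=l$ when the phase $\theta$ of $r$, measured relative to the phase of $d$, satisfies $(2l-1)\pi/M\le\theta<(2l+1)\pi/M$ (angles modulo $2\pi$). Let $P_{l,0}=P(y=l\mid x=0)$. The capacity in nats per symbol (natural logarithm) is $C_M(\mathrm{SNR})=\log M+\sum_{l=0}^{M-1}P_{l,0}\log P_{l,0}$, $\mathrm{SNR}\ge0$. Let $\dot C_M(0)$, $\ddot C_M(0)$ be its first and second right derivatives with respect to $\mathrm{SNR}$ at $\mathrm{SNR}=0$ (in nats), the latter possibly being $+\infty$. The received bit energy is $\frac{E_b^r}{N_0}=\frac{(|d|^2+\gamma^2)\mathrm{SNR}}{C(\mathrm{SNR})}$ with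 $C$ the capacity in bits per symbol, and the spectral efficiency $\mathsf{C}$ is $C(\mathrm{SNR})$ in bits/s/Hz. The received bit energy at zero spectral efficiency is the limit of $E_b^r/N_0$ as $\mathrm{SNR}\to0$, i.e. $\frac{(|d|^2+\gamma^2)\log_e2}{\dot C_M(0)}$, and the wideband slope is $S_0=\frac{2(\dot C_M(0))^2}{-\ddot C_M(0)}$, with $S_0=0$ when $\ddot C_M(0)=\infty$. *)

theory Defs
  imports "HOL-Analysis.Analysis"
begin

(* Parameters: M = constellation size, d = mean of the fading coefficient,
   g = its standard deviation (so g^2 is the fading variance), N0 = noise level,
   snr = signal energy / N0. *)

definition psk_signal :: "nat \<Rightarrow> real \<Rightarrow> nat \<Rightarrow> complex" where
  "psk_signal M energy m = of_real (sqrt energy) * exp (\<i> * of_real (2 * pi * real m / real M))"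

definition channel_density :: "complex \<Rightarrow> real \<Rightarrow> real \<Rightarrow> complex \<Rightarrow> complex \<Rightarrow> real" where
  "channel_density d g N0 s r =
     1 / (pi * (g\<^sup>2 * (cmod s)\<^sup>2 + N0))
       * exp (- ((cmod (r - d * s))\<^sup>2 / (g\<^sup>2 * (cmod s)\<^sup>2 + N0)))"

(* The phase of r relative to the phase of d is Arg (r / d), up to multiples of 2 pi.
   Since Arg 0 = 0, the null event r = 0 is put into region 0, so that the regions with
   l < M partition the plane. *)
definition decision_region :: "nat \<Rightarrow> complex \<Rightarrow> nat \<Rightarrow> complex set" where
  "decision_region M d l =
     {r. \<exists>k::int. (2 * real l - 1) * pi / real M \<le> Arg (r / d) + 2 * pi * of_int k
                \<and> Arg (r / d) + 2 * pi * of_int k < (2 * real l + 1) * pi / real M}"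

definition transition_prob ::
    "nat \<Rightarrow> complex \<Rightarrow> real \<Rightarrow> real \<Rightarrow> real \<Rightarrow> nat \<Rightarrow> nat \<Rightarrow> real" where
  "transition_prob M d g N0 snr l m =
     measure (density lborel
                (\<lambda>r. ennreal (channel_density d g N0 (psk_signal M (snr * N0) m) r)))
             (decision_region M d l)"

(* in nats per symbol *)
definition psk_capacity :: "nat \<Rightarrow> complex \<Rightarrow> real \<Rightarrow> real \<Rightarrow> real \<Rightarrow> real" where
  "psk_capacity M d g N0 snr =
     ln (real M) + (\<Sum>l<M. transition_prob M d g N0 snr l 0 * ln (transition_prob M d g N0 snr l 0))"

definition right_deriv :: "(real \<Rightarrow> real) \<Rightarrow> real \<Rightarrow> real" where
  "right_deriv f x = Lim (at_right x) (\<lambda>y. (f y - f x) / (y - x))"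

(* Extended-real valued, since the second right derivative may be infinite. *)
definition right_deriv2 :: "(real \<Rightarrow> real) \<Rightarrow> real \<Rightarrow> ereal" where
  "right_deriv2 f x = Lim (at_right x) (\<lambda>y. ereal ((right_deriv f y - right_deriv f x) / (y - x)))"

definition rician_factor :: "complex \<Rightarrow> real \<Rightarrow> real" where
  "rician_factor d g = (cmod d)\<^sup>2 / g\<^sup>2"

(* The division by ln 2 converts the capacity to bits. *)
definition received_bit_energy :: "nat \<Rightarrow> complex \<Rightarrow> real \<Rightarrow> real \<Rightarrow> real \<Rightarrow> real" where
  "received_bit_energy M d g N0 snr =
     ((cmod d)\<^sup>2 + g\<^sup>2) * snr / (psk_capacity M d g N0 snr / ln 2)"

definition received_bit_energy_at_zero :: "nat \<Rightarrow> complex \<Rightarrow> real \<Rightarrow> real \<Rightarrow> real" where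
  "received_bit_energy_at_zero M d g N0 =
     ((cmod d)\<^sup>2 + g\<^sup>2) * ln 2 / right_deriv (psk_capacity M d g N0) 0"

definition wideband_slope :: "nat \<Rightarrow> complex \<Rightarrow> real \<Rightarrow> real \<Rightarrow> real" where
  "wideband_slope M d g N0 =
     (let C1 = right_deriv (psk_capacity M d g N0) 0;
          C2 = right_deriv2 (psk_capacity M d g N0) 0
      in if C2 = \<infinity> then 0 else 2 * C1\<^sup>2 / (- real_of_ereal C2))"

definition psi :: "nat \<Rightarrow> real" where
  "psi M = (real M)\<^sup>2 / (16 * pi\<^sup>2) *
     ((2 - pi) * (sin (2 * pi / real M))\<^sup>2
      + ((real M)\<^sup>2 - 4 * pi) * sin (pi / real M) ^ 4
      - 2 * real M * (sin (pi / real M))\<^sup>2 * sin (2 * pi / real M))"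

end

theory Submission
  imports Defs "HOL-Probability.Distributions"
begin

text \<open>
  After rotating and rescaling the plane, the output phase lies in a fixed wedge around the angle
  \<open>\<phi>\<close>, under a standard complex Gaussian with real mean \<open>a\<close>, where
  \<open>a\<^sup>2 = |d|\<^sup>2 s / (1 + g\<^sup>2 s)\<close> at SNR \<open>s\<close>. In polar coordinates the wedge probability is an
  integral over the angle, and its derivative in \<open>a\<close> is the difference of an explicit flux through
  the two bounding rays. Expanding this flux at \<open>a = 0\<close> gives the derivative of the entropy as
  \<open>A a + B a\<^sup>2 + G a\<^sup>3 + o(a\<^sup>3)\<close>, with coefficients that are trigonometric sums over the
  constellation. Since \<open>a\<close> is of order \<open>sqrt s\<close>, the first derivative of the capacity at 0 is given by
  \<open>A\<close>; the second one is given by \<open>A\<close> and \<open>G\<close> when \<open>B = 0\<close>, and is infinite when \<open>B > 0\<close>, which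
  happens only for \<open>M = 3\<close>.
\<close>

section \<open>Lebesgue measure in the complex plane\<close>

text \<open>The obstacle is that \<open>a\<close> behaves like a square root of the SNR and has no
  derivative at SNR 0, so expansions are made in \<open>a\<close> and limits are one-sided. The
  chain rule divides the derivative of the entropy by \<open>2 * a\<close>: its linear term becomes
  a constant, its quadratic term a multiple of \<open>sqrt s\<close>, its cubic term a multiple of
  \<open>s\<close>. Hence order three is exactly what the second derivative needs. Two facts keep
  the expansion short. The net fluxes of all wedges add up to 0, so a factor \<open>M\<close> may be
  put inside each logarithm; the logarithm then starts at order \<open>a\<close>, and the fluxes
  matter only up to order two. The wedge probabilities are integrals of these fluxes in
  \<open>a\<close>, so the same three edge coefficients serve for both. The cases of the result come
  from sums of \<open>cos (j * \<phi>)\<close> over the constellation for \<open>j\<close> from 1 to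
  4, which vanish unless \<open>M\<close> divides \<open>j\<close>.\<close>

lemma measurable_Complex[measurable]:
  "(\<lambda>(x, y). Complex x y) \<in> borel_measurable (lborel \<Otimes>\<^sub>M lborel)"
  unfolding Complex_eq by measurable

text \<open>The measure \<open>lborel\<close> is determined by the volumes of boxes, and a box of
  complex numbers is a product of two intervals.\<close>

lemma lborel_complex_eq_distr:
  "(lborel :: complex measure) = distr (lborel \<Otimes>\<^sub>M lborel) borel (\<lambda>(x, y). Complex x y)"
proof (rule lborel_eqI)
  fix l u :: complex
  assume "\<And>b. b \<in> Basis \<Longrightarrow> l \<bullet> b \<le> u \<bullet> b"
  from this[of 1] this[of \<i>] have le: "Re l \<le> Re u" "Im l \<le> Im u"
    by (auto simp: inner_complex_def)
  have eq: "(\<lambda>(x, y). Complex x y) -` box l u = box (Re l) (Re u) \<times> box (Im l) (Im u)"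
    by (auto simp: box_def Basis_complex_def inner_complex_def)
  show "emeasure (distr (lborel \<Otimes>\<^sub>M lborel) borel (\<lambda>(x, y). Complex x y)) (box l u)
      = ennreal (\<Prod>b\<in>Basis. (u - l) \<bullet> b)"
    using le by (subst emeasure_distr)
      (auto simp: eq space_pair_measure lborel.emeasure_pair_measure_Times Basis_complex_def
         inner_complex_def ennreal_mult)
qed simp

lemma measurable_Complex'[measurable]:
  assumes [measurable]: "f \<in> borel_measurable M" "g \<in> borel_measurable M"
  shows "(\<lambda>x. Complex (f x) (g x)) \<in> borel_measurable M"
  unfolding Complex_eq by measurable

lemma nn_integral_lborel_complex:
  assumes [measurable]: "f \<in> borel_measurable borel"
  shows "(\<integral>\<^sup>+z. f z \<partial>lborel) = (\<integral>\<^sup>+y. (\<integral>\<^sup>+x. f (Complex x y) \<partial>lborel) \<partial>lborel)"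
    and "(\<integral>\<^sup>+z. f z \<partial>lborel) = (\<integral>\<^sup>+x. (\<integral>\<^sup>+y. f (Complex x y) \<partial>lborel) \<partial>lborel)"
proof -
  show "(\<integral>\<^sup>+z. f z \<partial>lborel) = (\<integral>\<^sup>+y. (\<integral>\<^sup>+x. f (Complex x y) \<partial>lborel) \<partial>lborel)"
    by (subst lborel_complex_eq_distr)
       (simp add: nn_integral_distr case_prod_beta' flip: lborel_pair.nn_integral_snd)
  also have "\<dots> = (\<integral>\<^sup>+x. (\<integral>\<^sup>+y. f (Complex x y) \<partial>lborel) \<partial>lborel)"
    by (rule lborel_pair.Fubini') measurable
  finally show "(\<integral>\<^sup>+z. f z \<partial>lborel) = (\<integral>\<^sup>+x. (\<integral>\<^sup>+y. f (Complex x y) \<partial>lborel) \<partial>lborel)" .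
qed

text \<open>If the real part \<open>p\<close> of \<open>c\<close> is nonzero, multiplication by
  \<open>c\<close> is a composition of two maps, each changing one coordinate affinely while the
  other is fixed; their factors \<open>(p^2 + q^2) / p\<close> and \<open>p\<close> multiply to the
  squared modulus.\<close>

lemma nn_integral_lborel_complex_mult:
  fixes c :: complex
  assumes f[measurable]: "f \<in> borel_measurable borel" and "c \<noteq> 0"
  shows "(\<integral>\<^sup>+z. f z \<partial>lborel) = ennreal ((cmod c)\<^sup>2) * (\<integral>\<^sup>+z. f (c * z) \<partial>lborel)"
proof -
  have *: "(\<integral>\<^sup>+z. f z \<partial>lborel) = ennreal ((cmod c)\<^sup>2) * (\<integral>\<^sup>+z. f (c * z) \<partial>lborel)"
    if "Re c \<noteq> 0" and f[measurable]: "f \<in> borel_measurable borel" for c and f :: "complex \<Rightarrow> ennreal"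
  proof -
    define p q where "p = Re c" and "q = Im c"
    have c: "c = Complex p q" and p: "p \<noteq> 0"
      using that by (auto simp: p_def q_def)
    \<comment> \<open>If \<open>u\<close> is the real part of \<open>c * z\<close> and
      \<open>y\<close> the imaginary part of \<open>z\<close>, then the imaginary part of
      \<open>c * z\<close> is \<open>q / p * u + (p^2 + q^2) / p * y\<close>.\<close>
    have inner: "(\<integral>\<^sup>+y. f (Complex u y) \<partial>lborel) = ennreal \<bar>(p\<^sup>2 + q\<^sup>2) / p\<bar> *
        (\<integral>\<^sup>+y. f (Complex u (q / p * u + (p\<^sup>2 + q\<^sup>2) / p * y)) \<partial>lborel)" for u
      using p by (subst nn_integral_real_affine[where t = "q / p * u" and c = "(p\<^sup>2 + q\<^sup>2) / p"])
        (simp_all add: sum_power2_eq_zero_iff)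
    have outer: "(\<integral>\<^sup>+x. f (Complex x (q / p * x + (p\<^sup>2 + q\<^sup>2) / p * y)) \<partial>lborel) =
        ennreal \<bar>p\<bar> * (\<integral>\<^sup>+x. f (c * Complex x y) \<partial>lborel)" for y
    proof -
      have "(\<integral>\<^sup>+x. f (Complex x (q / p * x + (p\<^sup>2 + q\<^sup>2) / p * y)) \<partial>lborel) =
        ennreal \<bar>p\<bar> * (\<integral>\<^sup>+x. f (Complex (- q * y + p * x)
           (q / p * (- q * y + p * x) + (p\<^sup>2 + q\<^sup>2) / p * y)) \<partial>lborel)"
        using p by (subst nn_integral_real_affine[where t = "- q * y" and c = p]) simp_all
      also have "(\<lambda>x. Complex (- q * y + p * x) (q / p * (- q * y + p * x) + (p\<^sup>2 + q\<^sup>2) / p * y))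
          = (\<lambda>x. c * Complex x y)"
        using p by (auto simp: c complex_eq_iff field_simps power2_eq_square)
      finally show ?thesis by (metis (no_types, lifting) ext)
    qed
    have "(\<integral>\<^sup>+z. f z \<partial>lborel) = ennreal \<bar>(p\<^sup>2 + q\<^sup>2) / p\<bar> * (\<integral>\<^sup>+x. (\<integral>\<^sup>+y. f (Complex x (q / p * x + (p\<^sup>2 + q\<^sup>2) / p * y)) \<partial>lborel) \<partial>lborel)"
      unfolding nn_integral_lborel_complex(2)[OF f] inner
      by (rule nn_integral_cmult) measurable
    also have "(\<integral>\<^sup>+x. (\<integral>\<^sup>+y. f (Complex x (q / p * x + (p\<^sup>2 + q\<^sup>2) / p * y)) \<partial>lborel) \<partial>lborel)
       = (\<integral>\<^sup>+y. (\<integral>\<^sup>+x. f (Complex x (q / p * x + (p\<^sup>2 + q\<^sup>2) / p * y)) \<partial>lborel) \<partial>lborel)"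
      by (rule lborel_pair.Fubini'[symmetric]) measurable
    also have "\<dots> = ennreal \<bar>p\<bar> * (\<integral>\<^sup>+y. (\<integral>\<^sup>+x. f (c * Complex x y) \<partial>lborel) \<partial>lborel)"
      unfolding outer by (rule nn_integral_cmult) measurable
    also have "(\<integral>\<^sup>+y. (\<integral>\<^sup>+x. f (c * Complex x y) \<partial>lborel) \<partial>lborel) = (\<integral>\<^sup>+z. f (c * z) \<partial>lborel)"
      by (subst nn_integral_lborel_complex(1)) simp_all
    also have "ennreal \<bar>(p\<^sup>2 + q\<^sup>2) / p\<bar> * (ennreal \<bar>p\<bar> * (\<integral>\<^sup>+z. f (c * z) \<partial>lborel)) =
        ennreal ((cmod c)\<^sup>2) * (\<integral>\<^sup>+z. f (c * z) \<partial>lborel)"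
      unfolding mult.assoc[symmetric] using p
      by (subst ennreal_mult[symmetric]) (auto simp: c cmod_power2 abs_mult[symmetric])
    finally show ?thesis .
  qed
  show ?thesis
  proof (cases "Re c = 0")
    case False
    then show ?thesis using * f by blast
  next
    case True
    \<comment> \<open>Factoring out \<open>1 + \<i>\<close> leaves two factors with nonzero real part.\<close>
    define c' where "c' = c * (1 - \<i>) / 2"
    have c: "c = (1 + \<i>) * c'"
      by (simp add: c'_def algebra_simps)
    have "Re c' = Im c / 2" using True by (simp add: c'_def)
    moreover have "Im c \<noteq> 0" using True \<open>c \<noteq> 0\<close> by (auto simp: complex_eq_iff)
    ultimately have c': "Re c' \<noteq> 0" by simp
    have "(\<integral>\<^sup>+z. f z \<partial>lborel) = ennreal ((cmod (1 + \<i>))\<^sup>2) * (\<integral>\<^sup>+z. f ((1 + \<i>) * z) \<partial>lborel)"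
      by (rule *) auto
    also have "(\<integral>\<^sup>+z. f ((1 + \<i>) * z) \<partial>lborel) = ennreal ((cmod c')\<^sup>2) * (\<integral>\<^sup>+z. f ((1 + \<i>) * (c' * z)) \<partial>lborel)"
      by (rule *[OF c']) measurable
    finally show ?thesis
      by (simp add: c norm_mult power_mult_distrib ennreal_mult mult.assoc)
  qed
qed

section \<open>The phase, and integration over wedges by slope and by angle\<close>

lemma borel_measurable_Arg[measurable]: "Arg \<in> borel_measurable borel"
proof -
  have [measurable]: "(\<lambda>z. if z \<in> - \<real>\<^sub>\<le>\<^sub>0 then Arg z else 0) \<in> borel_measurable borel"
    by (rule borel_measurable_continuous_on_if) (auto intro: continuous_on_Arg)
  have "(\<lambda>z. if Re z \<le> 0 \<and> Im z = 0 then if Re z = 0 then 0 else pi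
      else (if z \<in> - \<real>\<^sub>\<le>\<^sub>0 then Arg z else 0)) \<in> borel_measurable borel"
    by measurable
  also have "(\<lambda>z. if Re z \<le> 0 \<and> Im z = 0 then if Re z = 0 then 0 else pi
      else (if z \<in> - \<real>\<^sub>\<le>\<^sub>0 then Arg z else 0)) = Arg"
    by (auto simp: fun_eq_iff complex_nonpos_Reals_iff Arg_eq_0_iff complex_is_Real_iff
      intro!: Arg_eq_pi[THEN iffD2, symmetric])
  finally show ?thesis .
qed

text \<open>The slope \<open>t = y / x\<close> replaces the angle because for fixed \<open>x\<close>
  it is a linear substitution with Jacobian \<open>x\<close>. The bound on \<open>\<alpha>\<close>
  keeps the wedge in the closed right half-plane, where slopes describe it up to a null set.\<close>

lemma nn_integral_wedge:
  assumes f[measurable]: "f \<in> borel_measurable borel" and \<alpha>: "0 < \<alpha>" "\<alpha> \<le> pi / 2"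
  shows "(\<integral>\<^sup>+z. f z * indicator {z. - \<alpha> \<le> Arg z \<and> Arg z < \<alpha>} z \<partial>lborel) =
    (\<integral>\<^sup>+t. (\<integral>\<^sup>+x. ennreal x * f (Complex x (x * t)) * indicator {0..} x \<partial>lborel) *
       indicator {t. - \<alpha> \<le> arctan t \<and> arctan t < \<alpha>} t \<partial>lborel)"
proof -
  let ?W = "{z. - \<alpha> \<le> Arg z \<and> Arg z < \<alpha>}" and ?V = "{t. - \<alpha> \<le> arctan t \<and> arctan t < \<alpha>}"
  have W[measurable]: "?W \<in> sets borel" by measurable
  have [measurable]: "arctan \<in> borel_measurable borel"
    by (intro borel_measurable_continuous_onI continuous_intros) 
  have V[measurable]: "?V \<in> sets borel" by measurable
  have 1: "(\<integral>\<^sup>+y. f (Complex x y) * indicator ?W (Complex x y) \<partial>lborel) =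
    (\<integral>\<^sup>+t. ennreal x * f (Complex x (x * t)) * indicator {0..} x * indicator ?V t \<partial>lborel)" if "x \<noteq> 0" for x
  proof (cases "x > 0")
    case True
    have Arg: "Arg (Complex x (x * t)) = arctan t" for t
      using True by (subst arg_conv_arctan) auto
    have "(\<integral>\<^sup>+y. f (Complex x y) * indicator ?W (Complex x y) \<partial>lborel) =
       ennreal \<bar>x\<bar> * (\<integral>\<^sup>+t. f (Complex x (0 + x * t)) * indicator ?W (Complex x (0 + x * t)) \<partial>lborel)"
      using True by (subst nn_integral_real_affine[where t = 0 and c = x]) simp_all
    also have "\<dots> = (\<integral>\<^sup>+t. ennreal \<bar>x\<bar> * (f (Complex x (0 + x * t)) * indicator ?W (Complex x (0 + x * t))) \<partial>lborel)"
      by (rule nn_integral_cmult[symmetric]) measurable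
    also have "\<dots> = (\<integral>\<^sup>+t. ennreal x * f (Complex x (x * t)) * indicator {0..} x * indicator ?V t \<partial>lborel)"
      using True by (intro nn_integral_cong) (auto simp: Arg indicator_def)
    finally show ?thesis .
  next
    case False
    then have "x < 0" using that by simp
    have "Complex x y \<notin> ?W" for y
    proof
      assume "Complex x y \<in> ?W"
      then have "\<bar>Arg (Complex x y)\<bar> \<le> pi / 2" using \<alpha> by auto
      then show False using \<open>x < 0\<close> Arg_Re_nonneg[of "Complex x y"] by simp
    qed
    then show ?thesis using \<open>x < 0\<close> by simp
  qed
  have "(\<integral>\<^sup>+z. f z * indicator ?W z \<partial>lborel) =
      (\<integral>\<^sup>+x. (\<integral>\<^sup>+y. f (Complex x y) * indicator ?W (Complex x y) \<partial>lborel) \<partial>lborel)"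
    by (rule nn_integral_lborel_complex) measurable
  also have "\<dots> = (\<integral>\<^sup>+x. (\<integral>\<^sup>+t. ennreal x * f (Complex x (x * t)) * indicator {0..} x * indicator ?V t \<partial>lborel) \<partial>lborel)"
    \<comment> \<open>The line \<open>x = 0\<close> is null; for \<open>\<alpha> = pi / 2\<close> it
      contains a bounding ray.\<close>
    by (rule nn_integral_cong_AE, rule eventually_mono[OF AE_lborel_singleton[of 0]]) (rule 1)
  also have "\<dots> = (\<integral>\<^sup>+t. (\<integral>\<^sup>+x. ennreal x * f (Complex x (x * t)) * indicator {0..} x * indicator ?V t \<partial>lborel) \<partial>lborel)"
    by (rule lborel_pair.Fubini'[symmetric]) measurable
  also have "\<dots> = (\<integral>\<^sup>+t. (\<integral>\<^sup>+x. ennreal x * f (Complex x (x * t)) * indicator {0..} x \<partial>lborel) * indicator ?V t \<partial>lborel)"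
    by (intro nn_integral_cong nn_integral_multc) measurable
  finally show ?thesis .
qed

text \<open>Returns from slopes to angles. The function \<open>k\<close> is separate because
  \<open>h (tan x) / (cos x)^2\<close> is meaningless at the endpoints when
  \<open>\<alpha> = pi / 2\<close>, while the integrand to be used extends continuously.\<close>

lemma nn_integral_tan_substitution:
  fixes h k :: "real \<Rightarrow> real"
  assumes h[measurable]: "h \<in> borel_measurable borel" and nonneg: "\<And>t. h t \<ge> 0"
    and \<alpha>: "0 < \<alpha>" "\<alpha> \<le> pi / 2"
    and k: "continuous_on {- \<alpha>..\<alpha>} k"
    and hk: "\<And>x. - \<alpha> < x \<Longrightarrow> x < \<alpha> \<Longrightarrow> h (tan x) / (cos x)\<^sup>2 = k x"
  shows "(\<integral>\<^sup>+t. ennreal (h t) * indicator {t. - \<alpha> \<le> arctan t \<and> arctan t < \<alpha>} t \<partial>lborel) =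
    ennreal (integral {- \<alpha>..\<alpha>} k)"
proof -
  let ?S = "{- \<alpha><..<\<alpha>}"
  have cos: "cos x \<noteq> 0" if "x \<in> ?S" for x
    using that \<alpha> cos_gt_zero_pi[of x] by auto
  have img: "tan ` ?S = {t. - \<alpha> < arctan t \<and> arctan t < \<alpha>}"
  proof safe
    fix x assume "x \<in> ?S"
    then have "arctan (tan x) = x" using \<alpha> by (intro arctan_tan) auto
    then show "- \<alpha> < arctan (tan x)" "arctan (tan x) < \<alpha>" using \<open>x \<in> ?S\<close> by auto
  next
    fix t assume "- \<alpha> < arctan t" "arctan t < \<alpha>"
    then show "t \<in> tan ` ?S" by (intro image_eqI[of _ _ "arctan t"]) (auto simp: tan_arctan)
  qed
  have inj: "inj_on tan ?S"
  proof (rule inj_on_inverseI[of _ arctan])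
    show "arctan (tan x) = x" if "x \<in> ?S" for x
      using that \<alpha> by (intro arctan_tan) auto
  qed
  have der: "(tan has_field_derivative inverse ((cos x)\<^sup>2)) (at x within ?S)" if "x \<in> ?S" for x
    using cos[OF that] by (intro DERIV_subset[OF DERIV_tan]) auto
  have "k absolutely_integrable_on {- \<alpha>..\<alpha>}"
    using k absolutely_integrable_continuous_real by blast
  then have kS: "k absolutely_integrable_on ?S"
    by (rule set_integrable_subset) auto
  have "integral ?S k = integral {- \<alpha>..\<alpha>} k"
    using integral_open_interval[of "- \<alpha>" \<alpha> k] by simp
  moreover have "(\<lambda>x. \<bar>inverse ((cos x)\<^sup>2)\<bar> * h (tan x)) absolutely_integrable_on ?S \<longleftrightarrow> k absolutely_integrable_on ?S"
    using hk by (intro set_integrable_cong) (auto simp: field_simps)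
  moreover have "integral ?S (\<lambda>x. \<bar>inverse ((cos x)\<^sup>2)\<bar> * h (tan x)) = integral ?S k"
    using hk by (intro integral_cong) (auto simp: field_simps)
  ultimately have *: "h absolutely_integrable_on tan ` ?S" "integral (tan ` ?S) h = integral {- \<alpha>..\<alpha>} k"
    using has_absolute_integral_change_of_variables_1'[of ?S tan "\<lambda>x. inverse ((cos x)\<^sup>2)" h
       "integral {- \<alpha>..\<alpha>} k", OF _ der inj] kS by auto
  have [measurable]: "arctan \<in> borel_measurable borel"
    by (intro borel_measurable_continuous_onI continuous_intros)
  have m: "(\<lambda>t. if t \<in> tan ` ?S then h t else 0) \<in> borel_measurable borel"
    unfolding img by measurable
  have "(h has_integral integral {- \<alpha>..\<alpha>} k) (tan ` ?S)"
    using * set_lebesgue_integral_eq_integral(1) by (metis integrable_integral)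
  then have "((\<lambda>t. if t \<in> tan ` ?S then h t else 0) has_integral integral {- \<alpha>..\<alpha>} k) UNIV"
    by (simp only: has_integral_restrict_UNIV)
  from nn_integral_has_integral_lborel[OF m _ this]
  have "ennreal (integral {- \<alpha>..\<alpha>} k) = (\<integral>\<^sup>+t. ennreal (if t \<in> tan ` ?S then h t else 0) \<partial>lborel)"
    using nonneg by simp
  also have "\<dots> = (\<integral>\<^sup>+t. ennreal (h t) * indicator {t. - \<alpha> \<le> arctan t \<and> arctan t < \<alpha>} t \<partial>lborel)"
    unfolding img
  \<comment> \<open>The open interval misses the closed lower edge of the wedge, which is at most
    one slope.\<close>
  proof (intro nn_integral_cong_AE eventually_mono[OF AE_lborel_singleton[of "tan (- \<alpha>)"]])
    fix t assume "t \<noteq> tan (- \<alpha>)"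
    then have "arctan t \<noteq> - \<alpha>" using tan_arctan[of t] by metis
    then show "ennreal (if t \<in> {t. - \<alpha> < arctan t \<and> arctan t < \<alpha>} then h t else 0) =
         ennreal (h t) * indicator {t. - \<alpha> \<le> arctan t \<and> arctan t < \<alpha>} t"
      by (auto simp: indicator_def)
  qed
  finally show ?thesis by simp
qed

section \<open>Gaussian integrals\<close>

text \<open>The integral of \<open>exp (- t\<^sup>2)\<close> from minus infinity to \<open>x\<close>.\<close>

definition gauss_upto :: "real \<Rightarrow> real" where
  "gauss_upto x = sqrt pi / 2 + (LBINT t=0..x. exp (- t\<^sup>2))"

lemma gauss_upto_0 [simp]: "gauss_upto 0 = sqrt pi / 2"
  by (simp add: gauss_upto_def zero_ereal_def)

lemma DERIV_gauss_upto: "(gauss_upto has_real_derivative exp (- x\<^sup>2)) (at x)"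
proof -
  define b where "b = \<bar>x\<bar> + 1"
  have "((\<lambda>u. LBINT t=0..u. exp (- t\<^sup>2)) has_vector_derivative exp (- x\<^sup>2)) (at x within {-b..b})"
    unfolding zero_ereal_def
    by (rule interval_integral_FTC2) (auto simp: b_def intro!: continuous_intros)
  then have "((\<lambda>u. LBINT t=0..u. exp (- t\<^sup>2)) has_real_derivative exp (- x\<^sup>2)) (at x)"
    by (subst (asm) at_within_interior)
       (auto simp: b_def interior_atLeastAtMost_real has_real_derivative_iff_has_vector_derivative)
  from DERIV_add[OF DERIV_const this] show ?thesis
    by (simp add: gauss_upto_def[abs_def])
qed

lemma gauss_upto_minus: "gauss_upto (- x) = sqrt pi - gauss_upto x"
proof -
  have "\<exists>c. \<forall>x. gauss_upto x + gauss_upto (- x) = c"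
  proof (intro exI allI)
    fix x
    have "((\<lambda>x. gauss_upto x + gauss_upto (- x)) has_real_derivative 0) (at x)" for x
      by (rule derivative_eq_intros DERIV_gauss_upto DERIV_chain2[OF DERIV_gauss_upto] refl)+ simp
    then show "gauss_upto x + gauss_upto (- x) = gauss_upto 0 + gauss_upto (- 0)"
      by (intro DERIV_isconst_all) auto
  qed
  then obtain c where c: "\<And>x. gauss_upto x + gauss_upto (- x) = c" by blast
  from c[of 0] c[of x] show ?thesis by simp
qed

lemma gauss_upto_at_top: "(gauss_upto \<longlongrightarrow> sqrt pi) at_top"
proof -
  have "((\<lambda>y. \<integral>x. indicator {..y} x *\<^sub>R (indicator {0..} x *\<^sub>R exp (- x\<^sup>2)) \<partial>lborel)
      \<longlongrightarrow> (\<integral>x. indicator {0..} x *\<^sub>R exp (- x\<^sup>2) \<partial>(lborel :: real measure))) at_top"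
    using gaussian_moment_0 by (intro tendsto_integral_at_top) (auto simp: has_bochner_integral_iff)
  then have *: "((\<lambda>y. \<integral>x. indicator {..y} x *\<^sub>R (indicator {0..} x *\<^sub>R exp (- x\<^sup>2)) \<partial>lborel)
      \<longlongrightarrow> sqrt pi / 2) (at_top :: real filter)"
    unfolding has_bochner_integral_integral_eq[OF gaussian_moment_0] .
  have "((\<lambda>y. LBINT t=0..ereal y. exp (- t\<^sup>2)) \<longlongrightarrow> sqrt pi / 2) (at_top :: real filter)"
  proof (rule Lim_transform_eventually[OF *])
    show "\<forall>\<^sub>F y in at_top. (\<integral>x. indicator {..y} x *\<^sub>R (indicator {0..} x *\<^sub>R exp (- x\<^sup>2)) \<partial>lborel)
        = (LBINT t=0..ereal y. exp (- t\<^sup>2))"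
      using eventually_ge_at_top[of "0 :: real"]
    proof eventually_elim
      case (elim y)
      then show ?case
        unfolding zero_ereal_def
        by (subst interval_integral_Icc)
           (auto simp: set_lebesgue_integral_def indicator_def intro!: Bochner_Integration.integral_cong)
    qed
  qed
  from tendsto_add[OF tendsto_const[of "sqrt pi / 2"] this] show ?thesis
    by (simp add: gauss_upto_def[abs_def])
qed

text \<open>The Mills ratio of the density \<open>exp (- t\<^sup>2)\<close> at \<open>- v\<close>.\<close>

definition mills :: "real \<Rightarrow> real" where
  "mills v = exp (v\<^sup>2) * gauss_upto v"

text \<open>This linear first-order equation keeps all later derivatives combinations of
  \<open>mills\<close> itself and elementary functions.\<close>

lemma DERIV_mills: "(mills has_real_derivative 2 * v * mills v + 1) (at v)"
proof -
  have "(mills has_real_derivative exp (v\<^sup>2) * (2 * v) * gauss_upto v + exp (- v\<^sup>2) * exp (v\<^sup>2)) (at v)"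
    unfolding mills_def[abs_def]
    by (rule derivative_eq_intros DERIV_gauss_upto refl | simp)+
  then show ?thesis by (simp add: mills_def mult_ac flip: exp_add)
qed

lemma mills_0 [simp]: "mills 0 = sqrt pi / 2"
  by (simp add: mills_def)

lemma continuous_on_mills [continuous_intros]:
  "continuous_on S f \<Longrightarrow> continuous_on S (\<lambda>x. mills (f x))"
  by (rule continuous_on_compose2[OF DERIV_continuous_on[OF has_field_derivative_at_within[OF DERIV_mills]]])
     (assumption, rule subset_UNIV)

text \<open>Closed form of the integral of \<open>x * exp (- x^2 + 2 * v * x)\<close> over the
  positive half-line; the weight \<open>x\<close> is the polar Jacobian.\<close>

definition radial_gauss :: "real \<Rightarrow> real" where
  "radial_gauss v = 1 / 2 + v * mills v"

lemma continuous_on_radial_gauss [continuous_intros]: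
  "continuous_on S f \<Longrightarrow> continuous_on S (\<lambda>x. radial_gauss (f x))"
  unfolding radial_gauss_def by (intro continuous_intros)

lemma nn_integral_radial_gauss:
  "(\<integral>\<^sup>+x. ennreal (x * exp (- x\<^sup>2 + 2 * v * x)) * indicator {0..} x \<partial>lborel) = ennreal (radial_gauss v)"
proof -
  \<comment> \<open>Writing \<open>x = v - (2 * v - 2 * x) / 2\<close> splits the integrand into a
    multiple of a completed square and an exact derivative.\<close>
  define A where "A x = v * exp (v\<^sup>2) * gauss_upto (x - v) - exp (- x\<^sup>2 + 2 * v * x) / 2" for x
  have "(A \<longlongrightarrow> v * exp (v\<^sup>2) * sqrt pi - 0 / 2) at_top"
    unfolding A_def
  proof (intro tendsto_intros)
    show "((\<lambda>x. gauss_upto (x - v)) \<longlongrightarrow> sqrt pi) at_top"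
      by (rule filterlim_compose[OF gauss_upto_at_top]) real_asymp
    show "((\<lambda>x. exp (- x\<^sup>2 + 2 * v * x)) \<longlongrightarrow> 0) at_top"
      by real_asymp
  qed simp
  then have "(\<integral>\<^sup>+x. ennreal (x * exp (- x\<^sup>2 + 2 * v * x)) * indicator {0..} x \<partial>lborel)
      = ennreal (v * exp (v\<^sup>2) * sqrt pi - 0 / 2 - A 0)"
  proof (intro nn_integral_FTC_atLeast)
    fix x :: real
    have "(A has_real_derivative v * exp (v\<^sup>2) * exp (- (x - v)\<^sup>2) -
       exp (- x\<^sup>2 + 2 * v * x) * (2 * v - 2 * x) / 2) (at x)"
      unfolding A_def
      by (rule derivative_eq_intros DERIV_chain2[OF DERIV_gauss_upto] refl | simp)+
    also have "v * exp (v\<^sup>2) * exp (- (x - v)\<^sup>2) = v * exp (- x\<^sup>2 + 2 * v * x)"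
      by (simp add: power2_diff mult.assoc flip: exp_add)
    finally show "(A has_real_derivative x * exp (- x\<^sup>2 + 2 * v * x)) (at x)"
      by (simp add: algebra_simps diff_divide_distrib)
  qed auto
  also have "v * exp (v\<^sup>2) * sqrt pi - 0 / 2 - A 0 = radial_gauss v"
    by (simp add: A_def radial_gauss_def mills_def gauss_upto_minus algebra_simps)
  finally show ?thesis .
qed

text \<open>The closed form hides its sign for negative \<open>v\<close>. The integral is bounded
  below by its part over the unit interval, where the exponent is at least
  \<open>- 1 - 2 * \<bar>v\<bar>\<close>.\<close>

lemma radial_gauss_pos: "radial_gauss v > 0"
proof -
  have "ennreal (exp (- 1 - 2 * \<bar>v\<bar>) / 2) = (\<integral>\<^sup>+x. ennreal (x * exp (- 1 - 2 * \<bar>v\<bar>)) * indicator {0..1} x \<partial>lborel)"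
    by (subst nn_integral_FTC_Icc[where F = "\<lambda>x. x\<^sup>2 / 2 * exp (- 1 - 2 * \<bar>v\<bar>)"])
       (auto intro!: derivative_eq_intros)
  also have "\<dots> \<le> (\<integral>\<^sup>+x. ennreal (x * exp (- x\<^sup>2 + 2 * v * x)) * indicator {0..} x \<partial>lborel)"
  proof (intro nn_integral_mono)
    fix x :: real
    have "- 1 - 2 * \<bar>v\<bar> \<le> - x\<^sup>2 + 2 * v * x" if "0 \<le> x" "x \<le> 1"
    proof -
      have "x\<^sup>2 \<le> 1" using that by (simp add: power_le_one)
      moreover have "\<bar>v * x\<bar> \<le> \<bar>v\<bar>" using that by (simp add: abs_mult mult_left_le)
      ultimately show ?thesis by linarith
    qed
    then show "ennreal (x * exp (- 1 - 2 * \<bar>v\<bar>)) * indicator {0..1} x \<le>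
        ennreal (x * exp (- x\<^sup>2 + 2 * v * x)) * indicator {0..} x"
      by (auto simp: indicator_def intro!: ennreal_leI mult_left_mono)
  qed
  finally have "ennreal (exp (- 1 - 2 * \<bar>v\<bar>) / 2) \<le> ennreal (radial_gauss v)"
    unfolding nn_integral_radial_gauss .
  \<comment> \<open>Since \<open>ennreal\<close> truncates negative numbers to 0, the comparison
    leaves a second alternative, which positivity of \<open>exp\<close> excludes.\<close>
  then have "exp (- 1 - 2 * \<bar>v\<bar>) / 2 \<le> radial_gauss v \<or> exp (- 1 - 2 * \<bar>v\<bar>) / 2 \<le> 0"
    by (metis ennreal_le_iff2)
  then show ?thesis
    using exp_gt_zero[of "- 1 - 2 * \<bar>v\<bar>"] by linarith
qed

section \<open>Transition probabilities\<close>

text \<open>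
  The mass that a standard complex Gaussian with mean \<open>a\<close> gives to the wedge of half-angle \<open>\<alpha>\<close>
  around the direction \<open>\<phi>\<close>; the factor \<open>radial_gauss\<close> is the integral along a ray.
\<close>

definition wedge_prob :: "real \<Rightarrow> real \<Rightarrow> real \<Rightarrow> real" where
  "wedge_prob \<alpha> \<phi> a = exp (- a\<^sup>2) / pi * integral {- \<alpha>..\<alpha>} (\<lambda>\<theta>. radial_gauss (a * cos (\<theta> + \<phi>)))"

text \<open>Along the ray of slope \<open>t\<close> the exponent is quadratic in the distance
  \<open>x * sqrt (1 + t^2)\<close> from the origin, and \<open>w t\<close> is the cosine of the
  angle between the rotated ray and the real axis. Passing to the distance leaves a factor
  \<open>1 / (1 + t^2)\<close>, which cancels the Jacobian of the tangent.\<close>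

lemma nn_integral_wedge_gauss:
  assumes \<alpha>: "0 < \<alpha>" "\<alpha> \<le> pi / 2"
  shows "(\<integral>\<^sup>+z. ennreal (exp (- (cmod (cis \<phi> * z - of_real a))\<^sup>2) / pi) *
      indicator {z. - \<alpha> \<le> Arg z \<and> Arg z < \<alpha>} z \<partial>lborel) = ennreal (wedge_prob \<alpha> \<phi> a)"
proof -
  define w where "w t = (cos \<phi> - t * sin \<phi>) / sqrt (1 + t\<^sup>2)" for t
  define h where "h t = exp (- a\<^sup>2) / (pi * (1 + t\<^sup>2)) * radial_gauss (a * w t)" for t
  have q: "sqrt (1 + t\<^sup>2) > 0" "1 + t\<^sup>2 > 0" for t :: real
    by (auto intro: add_pos_nonneg)
  have q0: "1 + t\<^sup>2 \<noteq> 0" for t :: real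
    using q(2)[of t] by simp
  have meas: "(\<lambda>z. ennreal (exp (- (cmod (cis \<phi> * z - of_real a))\<^sup>2) / pi)) \<in> borel_measurable borel"
    by measurable
  have inner: "(\<integral>\<^sup>+x. ennreal x * ennreal (exp (- (cmod (cis \<phi> * Complex x (x * t) - of_real a))\<^sup>2) / pi) *
     indicator {0..} x \<partial>lborel) = ennreal (h t)" for t
  proof -
    define r where "r = sqrt (1 + t\<^sup>2)"
    have r: "r > 0" "r\<^sup>2 = 1 + t\<^sup>2"
      using q[of t] by (auto simp: r_def)
    have sq: "(cmod (cis \<phi> * Complex (0 + 1 / r * x) ((0 + 1 / r * x) * t) - of_real a))\<^sup>2 =
        x\<^sup>2 - 2 * (a * w t) * x + a\<^sup>2" for x
    proof -
      have "(cmod (cis \<phi> * Complex (0 + 1 / r * x) ((0 + 1 / r * x) * t) - of_real a))\<^sup>2 =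
         (x / r * (cos \<phi> - t * sin \<phi>) - a)\<^sup>2 + (x / r * (sin \<phi> + t * cos \<phi>))\<^sup>2"
        by (simp add: cmod_power2 algebra_simps)
      also have "\<dots> = (x / r)\<^sup>2 * ((1 + t\<^sup>2) * ((sin \<phi>)\<^sup>2 + (cos \<phi>)\<^sup>2)) - 2 * (a * (cos \<phi> - t * sin \<phi>)) * (x / r) + a\<^sup>2"
        by algebra
      also have "(x / r)\<^sup>2 * ((1 + t\<^sup>2) * ((sin \<phi>)\<^sup>2 + (cos \<phi>)\<^sup>2)) = x\<^sup>2"
        using r by (simp add: power_divide q0)
      finally show ?thesis by (simp add: w_def r_def)
    qed
    have "(\<integral>\<^sup>+x. ennreal x * ennreal (exp (- (cmod (cis \<phi> * Complex x (x * t) - of_real a))\<^sup>2) / pi) *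
       indicator {0..} x \<partial>lborel) =
       ennreal \<bar>1 / r\<bar> * (\<integral>\<^sup>+x. ennreal (0 + 1 / r * x) * ennreal (exp (- (cmod (cis \<phi> * Complex (0 + 1 / r * x) ((0 + 1 / r * x) * t) - of_real a))\<^sup>2) / pi) *
       indicator {0..} (0 + 1 / r * x) \<partial>lborel)"
      using r by (intro nn_integral_real_affine[where t = 0 and c = "1 / r"]) simp_all
    also have "\<dots> = ennreal \<bar>1 / r\<bar> * (\<integral>\<^sup>+x. ennreal (exp (- a\<^sup>2) / (pi * r)) *
         (ennreal (x * exp (- x\<^sup>2 + 2 * (a * w t) * x)) * indicator {0..} x) \<partial>lborel)"
    proof (rule arg_cong[of _ _ "(*) (ennreal \<bar>1 / r\<bar>)"], rule nn_integral_cong)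
      fix x :: real
      have "exp (- (x\<^sup>2 - 2 * (a * w t) * x + a\<^sup>2)) = exp (- a\<^sup>2) * exp (- x\<^sup>2 + 2 * (a * w t) * x)"
        by (simp flip: exp_add)
      then have "(0 + 1 / r * x) * (exp (- (x\<^sup>2 - 2 * (a * w t) * x + a\<^sup>2)) / pi) =
          exp (- a\<^sup>2) / (pi * r) * (x * exp (- x\<^sup>2 + 2 * (a * w t) * x))"
        by (simp add: mult_ac)
      moreover have "0 + 1 / r * x \<ge> 0 \<longleftrightarrow> x \<ge> 0"
        using r by (simp add: zero_le_divide_iff)
      ultimately show "ennreal (0 + 1 / r * x) * ennreal (exp (- (cmod (cis \<phi> * Complex (0 + 1 / r * x) ((0 + 1 / r * x) * t) - of_real a))\<^sup>2) / pi) *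
         indicator {0..} (0 + 1 / r * x) = ennreal (exp (- a\<^sup>2) / (pi * r)) *
           (ennreal (x * exp (- x\<^sup>2 + 2 * (a * w t) * x)) * indicator {0..} x)"
        unfolding sq using r
        by (cases "x \<ge> 0") (simp_all add: indicator_def flip: ennreal_mult)
    qed
    also have "\<dots> = ennreal \<bar>1 / r\<bar> * (ennreal (exp (- a\<^sup>2) / (pi * r)) * ennreal (radial_gauss (a * w t)))"
      by (subst nn_integral_cmult) (simp_all only: nn_integral_radial_gauss, simp)
    also have "\<dots> = ennreal (h t)"
      using r radial_gauss_pos[of "a * w t"]
      by (simp add: h_def power2_eq_square flip: ennreal_mult)
    finally show ?thesis .
  qed
  have cont: "continuous_on UNIV h"
    unfolding h_def w_def by (intro continuous_intros) (auto simp: q0)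
  have "(\<integral>\<^sup>+z. ennreal (exp (- (cmod (cis \<phi> * z - of_real a))\<^sup>2) / pi) *
      indicator {z. - \<alpha> \<le> Arg z \<and> Arg z < \<alpha>} z \<partial>lborel) =
      (\<integral>\<^sup>+t. ennreal (h t) * indicator {t. - \<alpha> \<le> arctan t \<and> arctan t < \<alpha>} t \<partial>lborel)"
    unfolding nn_integral_wedge[OF meas \<alpha>] inner ..
  also have "\<dots> = ennreal (integral {- \<alpha>..\<alpha>} (\<lambda>\<theta>. exp (- a\<^sup>2) / pi * radial_gauss (a * cos (\<theta> + \<phi>))))"
  proof (rule nn_integral_tan_substitution[OF _ _ \<alpha>])
    show "h \<in> borel_measurable borel"
      using cont by (rule borel_measurable_continuous_onI)
    show "h t \<ge> 0" for t
      using radial_gauss_pos[of "a * w t"] q[of t] by (simp add: h_def)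
    show "continuous_on {- \<alpha>..\<alpha>} (\<lambda>\<theta>. exp (- a\<^sup>2) / pi * radial_gauss (a * cos (\<theta> + \<phi>)))"
      by (intro continuous_intros) auto
    fix x assume x: "- \<alpha> < x" "x < \<alpha>"
    have c: "cos x > 0" using x \<alpha> by (intro cos_gt_zero_pi) auto
    have s: "1 + (tan x)\<^sup>2 = (1 / cos x)\<^sup>2"
      using c tan_sec[of x] by (simp add: inverse_eq_divide)
    have "w (tan x) = cos (x + \<phi>)"
      unfolding w_def s real_sqrt_abs using c by (simp add: tan_def cos_add field_simps)
    then show "h (tan x) / (cos x)\<^sup>2 = exp (- a\<^sup>2) / pi * radial_gauss (a * cos (x + \<phi>))"
      unfolding h_def s using c by (simp add: power_divide)
  qed
  finally show ?thesis
    by (simp add: wedge_prob_def)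
qed

lemma wedge_prob_pos:
  assumes "0 < \<alpha>"
  shows "wedge_prob \<alpha> \<phi> a > 0"
proof -
  have c: "continuous_on {- \<alpha>..\<alpha>} (\<lambda>\<theta>. radial_gauss (a * cos (\<theta> + \<phi>)))"
    by (intro continuous_intros)
  have "integral {- \<alpha>..\<alpha>} (\<lambda>\<theta>. radial_gauss (a * cos (\<theta> + \<phi>))) \<ge> 0"
    by (intro integral_nonneg integrable_continuous_interval c) (use radial_gauss_pos less_imp_le in blast)
  moreover have "integral {- \<alpha>..\<alpha>} (\<lambda>\<theta>. radial_gauss (a * cos (\<theta> + \<phi>))) \<noteq> 0"
  proof
    assume "integral {- \<alpha>..\<alpha>} (\<lambda>\<theta>. radial_gauss (a * cos (\<theta> + \<phi>))) = 0"
    then have "radial_gauss (a * cos (0 + \<phi>)) = 0"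
      using assms radial_gauss_pos less_imp_le integral_eq_0_iff[OF c]
      by (metis atLeastAtMost_iff neg_le_0_iff_le less_eq_real_def neg_less_0_iff_less order_less_trans)
    then show False using radial_gauss_pos[of "a * cos (0 + \<phi>)"] by linarith
  qed
  ultimately show ?thesis
    by (simp add: wedge_prob_def)
qed

lemma wedge_prob_0: "\<alpha> \<ge> 0 \<Longrightarrow> wedge_prob \<alpha> \<phi> 0 = \<alpha> / pi"
  by (simp add: wedge_prob_def radial_gauss_def)

section \<open>Decision regions as rotated wedges\<close>

lemma Arg_cis_mult:
  assumes "z \<noteq> 0"
  shows "\<exists>k::int. Arg (cis \<phi> * z) = Arg z + \<phi> + 2 * pi * of_int k"
proof -
  have "cis (Arg (cis \<phi> * z)) = cis (Arg z + \<phi>)"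
    using assms by (simp add: cis_Arg sgn_mult sgn_cis cis_mult[symmetric] mult.commute)
  then have "sin (Arg (cis \<phi> * z)) = sin (Arg z + \<phi>) \<and> cos (Arg (cis \<phi> * z)) = cos (Arg z + \<phi>)"
    by (simp add: complex_eq_iff)
  then show ?thesis
    unfolding sin_cos_eq_iff by auto
qed

lemma decision_region_rotate:
  assumes M: "M \<ge> 2" and "d \<noteq> 0" "z \<noteq> 0" "s > 0"
  shows "of_real s * (d / of_real (cmod d)) * cis (2 * pi * real l / real M) * z \<in> decision_region M d l
    \<longleftrightarrow> - (pi / M) \<le> Arg z \<and> Arg z < pi / M"
proof -
  define \<phi> where "\<phi> = 2 * pi * real l / real M"
  obtain k0 :: int where k0: "Arg (cis \<phi> * z) = Arg z + \<phi> + 2 * pi * of_int k0"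
    using Arg_cis_mult[OF \<open>z \<noteq> 0\<close>] by blast
  have "Arg (of_real s * (d / of_real (cmod d)) * cis \<phi> * z / d) = Arg (of_real (s / cmod d) * (cis \<phi> * z))"
    using assms by (intro arg_cong[of _ _ Arg]) (simp add: field_simps)
  also have "\<dots> = Arg (cis \<phi> * z)"
    using assms by (subst Arg_times_of_real) auto
  finally have A: "Arg (of_real s * (d / of_real (cmod d)) * cis \<phi> * z / d) = Arg z + \<phi> + 2 * pi * of_int k0"
    using k0 by simp
  have e: "(2 * real l - 1) * pi / real M = \<phi> - pi / M" "(2 * real l + 1) * pi / real M = \<phi> + pi / M"
    by (simp_all add: \<phi>_def algebra_simps add_divide_distrib diff_divide_distrib)
  have pM: "pi / M \<le> pi / 2" using M by (intro divide_left_mono) auto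
  have "of_real s * (d / of_real (cmod d)) * cis \<phi> * z \<in> decision_region M d l
     \<longleftrightarrow> (\<exists>k::int. - (pi / M) \<le> Arg z + 2 * pi * of_int (k0 + k) \<and> Arg z + 2 * pi * of_int (k0 + k) < pi / M)"
  proof -
    have "\<phi> - pi / M \<le> Arg z + \<phi> + 2 * pi * of_int k0 + 2 * pi * of_int k
        \<longleftrightarrow> - (pi / M) \<le> Arg z + 2 * pi * of_int (k0 + k)"
      "Arg z + \<phi> + 2 * pi * of_int k0 + 2 * pi * of_int k < \<phi> + pi / M
        \<longleftrightarrow> Arg z + 2 * pi * of_int (k0 + k) < pi / M" for k :: int
      by (auto simp: algebra_simps)
    then show ?thesis
      unfolding decision_region_def mem_Collect_eq A e by simp
  qed
  \<comment> \<open>The multiple \<open>k0\<close> of the full turn is absorbed into the quantified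
    integer.\<close>
  also have "\<dots> \<longleftrightarrow> (\<exists>k::int. - (pi / M) \<le> Arg z + 2 * pi * of_int k \<and> Arg z + 2 * pi * of_int k < pi / M)"
    by (metis add_diff_cancel_left' diff_add_cancel add.commute)
  also have "\<dots> \<longleftrightarrow> - (pi / M) \<le> Arg z \<and> Arg z < pi / M"
  proof
    assume "\<exists>k::int. - (pi / M) \<le> Arg z + 2 * pi * of_int k \<and> Arg z + 2 * pi * of_int k < pi / M"
    then obtain k :: int where k: "- (pi / M) \<le> Arg z + 2 * pi * of_int k" "Arg z + 2 * pi * of_int k < pi / M"
      by blast
    \<comment> \<open>Since \<open>Arg z\<close> has modulus at most \<open>pi\<close> and the
      half-angle is at most \<open>pi / 2\<close>, the multiple \<open>2 * pi * k\<close> has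
      modulus at most \<open>3 * pi / 2\<close>.\<close>
    have "pi * (- 1) < pi * of_int k" "pi * of_int k < pi * 1"
      using k pM mpi_less_Arg[of z] Arg_le_pi[of z] pi_gt_zero by linarith+
    then have "k = 0" unfolding mult_less_cancel_left_pos[OF pi_gt_zero] by linarith
    then show "- (pi / M) \<le> Arg z \<and> Arg z < pi / M" using k by simp
  qed (auto intro: exI[of _ 0])
  finally show ?thesis by (simp add: \<phi>_def)
qed

lemma decision_region_measurable [measurable]: "decision_region M d l \<in> sets borel"
  unfolding decision_region_def by measurable

lemma transition_prob_eq_wedge_prob:
  assumes M: "M \<ge> 2" and d: "d \<noteq> 0" and N0: "N0 > 0" and snr: "snr \<ge> 0"
  shows "transition_prob M d g N0 snr l 0 =
    wedge_prob (pi / M) (2 * pi * real l / real M) (cmod d * sqrt (snr / (1 + g\<^sup>2 * snr)))"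
proof -
  define a where "a = cmod d * sqrt (snr / (1 + g\<^sup>2 * snr))"
  define \<phi> where "\<phi> = 2 * pi * real l / real M"
  define V where "V = g\<^sup>2 * (snr * N0) + N0"
  have pos: "1 + g\<^sup>2 * snr > 0" using snr by (simp add: add_pos_nonneg)
  have V: "V = N0 * (1 + g\<^sup>2 * snr)" by (simp add: V_def algebra_simps)
  have Vpos: "V > 0" using pos N0 by (simp add: V)
  \<comment> \<open>Substituting \<open>r = c * z\<close> removes the phase of \<open>d\<close>,
    turns region \<open>l\<close> to the positive real axis and normalises the total variance
    \<open>V\<close>, to which fading contributes \<open>g^2 * snr * N0\<close>. The Jacobian is
    \<open>V\<close> and cancels the normalisation of the density.\<close>
  define c where "c = of_real (sqrt V) * (d / of_real (cmod d)) * cis \<phi>"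
  have cc: "(cmod c)\<^sup>2 = V"
    using Vpos d by (simp add: c_def norm_mult norm_divide)
  then have "c \<noteq> 0" using Vpos by auto
  have s: "psk_signal M (snr * N0) 0 = of_real (sqrt (snr * N0))"
    by (simp add: psk_signal_def)
  have cs: "(cmod (of_real (sqrt (snr * N0)) :: complex))\<^sup>2 = snr * N0"
    using snr N0 by simp
  have root: "sqrt (snr * N0) = sqrt V * sqrt (snr / (1 + g\<^sup>2 * snr))"
    using pos by (simp add: V flip: real_sqrt_mult)
  have dens: "channel_density d g N0 (psk_signal M (snr * N0) 0) (c * z) =
     exp (- (cmod (cis \<phi> * z - of_real a))\<^sup>2) / (pi * V)" for z
  proof -
    have "c * z - d * of_real (sqrt (snr * N0)) = of_real (sqrt V) * (d / of_real (cmod d)) * (cis \<phi> * z - of_real a)"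
      using d unfolding root by (simp add: c_def a_def field_simps)
    then have "(cmod (c * z - d * of_real (sqrt (snr * N0))))\<^sup>2 = V * (cmod (cis \<phi> * z - of_real a))\<^sup>2"
      using d Vpos by (simp add: norm_mult norm_divide power_mult_distrib)
    then show ?thesis
      unfolding channel_density_def s cs using Vpos by (simp add: V_def[symmetric])
  qed
  have [measurable]: "channel_density d g N0 (psk_signal M (snr * N0) 0) \<in> borel_measurable borel"
    unfolding channel_density_def by measurable
  have "emeasure (density lborel (\<lambda>r. ennreal (channel_density d g N0 (psk_signal M (snr * N0) 0) r))) (decision_region M d l)
     = (\<integral>\<^sup>+r. ennreal (channel_density d g N0 (psk_signal M (snr * N0) 0) r) * indicator (decision_region M d l) r \<partial>lborel)"
    by (rule emeasure_density) measurable
  also have "\<dots> = ennreal V * (\<integral>\<^sup>+z. ennreal (channel_density d g N0 (psk_signal M (snr * N0) 0) (c * z)) *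
       indicator (decision_region M d l) (c * z) \<partial>lborel)"
    unfolding cc[symmetric] by (rule nn_integral_lborel_complex_mult[OF _ \<open>c \<noteq> 0\<close>]) measurable
  also have "\<dots> = (\<integral>\<^sup>+z. ennreal V * (ennreal (channel_density d g N0 (psk_signal M (snr * N0) 0) (c * z)) *
       indicator (decision_region M d l) (c * z)) \<partial>lborel)"
    by (rule nn_integral_cmult[symmetric]) measurable
  also have "\<dots> = (\<integral>\<^sup>+z. ennreal (exp (- (cmod (cis \<phi> * z - of_real a))\<^sup>2) / pi) *
      indicator {z. - (pi / M) \<le> Arg z \<and> Arg z < pi / M} z \<partial>lborel)"
  proof (rule nn_integral_cong_AE, rule eventually_mono[OF AE_lborel_singleton[of 0]])
    fix z :: complex assume "z \<noteq> 0"
    have "c * z \<in> decision_region M d l \<longleftrightarrow> - (pi / M) \<le> Arg z \<and> Arg z < pi / M"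
      unfolding c_def \<phi>_def using M d \<open>z \<noteq> 0\<close> Vpos by (intro decision_region_rotate) auto
    then show "ennreal V * (ennreal (channel_density d g N0 (psk_signal M (snr * N0) 0) (c * z)) *
       indicator (decision_region M d l) (c * z)) =
       ennreal (exp (- (cmod (cis \<phi> * z - of_real a))\<^sup>2) / pi) *
      indicator {z. - (pi / M) \<le> Arg z \<and> Arg z < pi / M} z"
      unfolding dens using Vpos by (auto simp: indicator_def simp flip: ennreal_mult)
  qed
  also have "\<dots> = ennreal (wedge_prob (pi / M) \<phi> a)"
    using M by (intro nn_integral_wedge_gauss divide_left_mono) auto
  finally show ?thesis
    using wedge_prob_pos[of "pi / M" \<phi> a] M
    by (simp add: transition_prob_def measure_def a_def \<phi>_def)
qed

text \<open>The rate at which mass crosses the ray of angle \<open>\<beta>\<close> clockwise when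
  the mean moves along the real axis: \<open>sin \<beta>\<close> is the normal component of the
  motion, and the rest is the Gaussian density integrated along the ray.\<close>

definition edge_flux :: "real \<Rightarrow> real \<Rightarrow> real" where
  "edge_flux \<beta> a = sin \<beta> / pi * (exp (- a\<^sup>2) * mills (a * cos \<beta>))"

lemma DERIV_mills_chain:
  "(f has_real_derivative D) (at x within S) \<Longrightarrow>
    ((\<lambda>x. mills (f x)) has_real_derivative (2 * f x * mills (f x) + 1) * D) (at x within S)"
  by (rule DERIV_chain2[OF DERIV_mills])

lemma DERIV_wedge_prob:
  assumes "\<alpha> \<ge> 0"
  shows "(wedge_prob \<alpha> \<phi> has_real_derivative edge_flux (\<phi> + \<alpha>) a - edge_flux (\<phi> - \<alpha>) a) (at a)"
proof -
  define f where "f a \<theta> = exp (- a\<^sup>2) / pi * radial_gauss (a * cos (\<theta> + \<phi>))" for a \<theta>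
  define f' where "f' a \<theta> = exp (- a\<^sup>2) / pi * (cos (\<theta> + \<phi>) * mills (a * cos (\<theta> + \<phi>))
     - a * (sin (\<theta> + \<phi>))\<^sup>2 * (2 * (a * cos (\<theta> + \<phi>)) * mills (a * cos (\<theta> + \<phi>)) + 1))" for a \<theta>
  have "((\<lambda>a. integral (cbox (- \<alpha>) \<alpha>) (f a)) has_real_derivative integral (cbox (- \<alpha>) \<alpha>) (f' a)) (at a within UNIV)"
  proof (rule leibniz_rule_field_derivative)
    fix a \<theta> :: real
    define c m where "c = cos (\<theta> + \<phi>)" and "m = mills (a * c)"
    have "((\<lambda>a. f a \<theta>) has_real_derivative exp (- a\<^sup>2) / pi * (- 2 * a * (1 / 2 + a * c * m)
       + c * m + a * c * ((2 * (a * c) * m + 1) * c))) (at a within UNIV)"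
      unfolding f_def radial_gauss_def c_def m_def
      by (rule derivative_eq_intros DERIV_mills_chain refl | simp add: field_simps)+
    also have "exp (- a\<^sup>2) / pi * (- 2 * a * (1 / 2 + a * c * m)
       + c * m + a * c * ((2 * (a * c) * m + 1) * c)) = f' a \<theta>"
      unfolding f'_def c_def[symmetric] m_def[symmetric] sin_squared_eq
      by (simp add: power2_eq_square algebra_simps)
    finally show "((\<lambda>a. f a \<theta>) has_real_derivative f' a \<theta>) (at a within UNIV)" .
  next
    show "f a integrable_on cbox (- \<alpha>) \<alpha>" for a
      unfolding f_def by (intro integrable_continuous continuous_intros) auto
    show "continuous_on (UNIV \<times> cbox (- \<alpha>) \<alpha>) (\<lambda>(a, \<theta>). f' a \<theta>)"
      unfolding f'_def case_prod_beta' by (intro continuous_intros) auto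
  qed auto
  \<comment> \<open>The derivative of the integrand in \<open>a\<close> is the derivative of \<open>edge_flux\<close> in the angle.\<close>
  moreover have "(f' a has_integral edge_flux (\<alpha> + \<phi>) a - edge_flux (- \<alpha> + \<phi>) a) {- \<alpha>..\<alpha>}"
  proof (rule fundamental_theorem_of_calculus)
    fix \<theta>
    have "((\<lambda>\<theta>. edge_flux (\<theta> + \<phi>) a) has_real_derivative f' a \<theta>) (at \<theta> within {- \<alpha>..\<alpha>})"
      unfolding edge_flux_def f'_def
      by (rule derivative_eq_intros DERIV_mills_chain refl | simp add: field_simps power2_eq_square)+
    then show "((\<lambda>\<theta>. edge_flux (\<theta> + \<phi>) a) has_vector_derivative f' a \<theta>) (at \<theta> within {- \<alpha>..\<alpha>})"
      by (simp add: has_real_derivative_iff_has_vector_derivative)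
  qed (use assms in auto)
  ultimately show ?thesis
    by (simp add: wedge_prob_def[abs_def] f_def[abs_def] integral_unique add.commute flip: integral_mult_right)
qed

section \<open>Third-order expansions\<close>

text \<open>One-sided because the variable will be a square root of the SNR. The error is kept as
  \<open>a ^ 3\<close> times a vanishing factor, so that sums and products are pure algebra.\<close>

definition taylor3 :: "(real \<Rightarrow> real) \<Rightarrow> real \<Rightarrow> real \<Rightarrow> real \<Rightarrow> real \<Rightarrow> bool" where
  "taylor3 f c0 c1 c2 c3 \<longleftrightarrow>
    (\<exists>r. (\<forall>a>0. f a = c0 + c1 * a + c2 * a\<^sup>2 + c3 * a ^ 3 + a ^ 3 * r a) \<and> (r \<longlongrightarrow> 0) (at_right 0))"

lemma taylor3I:
  assumes "((\<lambda>a. (f a - (c0 + c1 * a + c2 * a\<^sup>2 + c3 * a ^ 3)) / a ^ 3) \<longlongrightarrow> 0) (at_right 0)"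
  shows "taylor3 f c0 c1 c2 c3"
  unfolding taylor3_def
  by (rule exI, rule conjI[OF _ assms]) (auto simp: field_simps)

text \<open>Three applications of l'Hopital's rule turn the remainder quotient into
  \<open>(f3 a - 6 * c3) / 6\<close>, which vanishes in the limit by continuity of \<open>f3\<close>
  at 0.\<close>

lemma taylor3_derivs:
  assumes f: "\<And>x. (f has_real_derivative f1 x) (at x)"
    and f1: "\<And>x. (f1 has_real_derivative f2 x) (at x)"
    and f2: "\<And>x. (f2 has_real_derivative f3 x) (at x)"
    and f3: "isCont f3 0"
    and c: "c0 = f 0" "c1 = f1 0" "c2 = f2 0 / 2" "c3 = f3 0 / 6"
  shows "taylor3 f c0 c1 c2 c3"
proof (rule taylor3I)
  note l = lhopital_right_0[where F = "nhds 0"]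
  have lim: "(g \<longlongrightarrow> 0) (at_right 0)" if "isCont g 0" "g 0 = 0" for g :: "real \<Rightarrow> real"
    using that unfolding isCont_def by (metis filterlim_at_split)
  note cont = DERIV_isCont[OF f] DERIV_isCont[OF f1] DERIV_isCont[OF f2] f3
  have ne: "eventually (\<lambda>x. k * x ^ n \<noteq> 0) (at_right 0)" if "k \<noteq> 0" for k :: real and n
    using that by (intro eventually_mono[OF eventually_at_right_less]) auto
  have d0: "((\<lambda>a. f a - (c0 + c1 * a + c2 * a\<^sup>2 + c3 * a ^ 3)) has_real_derivative
      f1 a - (c1 + 2 * c2 * a + 3 * c3 * a\<^sup>2)) (at a)" for a
    by (rule derivative_eq_intros f refl | simp)+
  have d1: "((\<lambda>a. f1 a - (c1 + 2 * c2 * a + 3 * c3 * a\<^sup>2)) has_real_derivative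
      f2 a - (2 * c2 + 6 * c3 * a)) (at a)" for a
    by (rule derivative_eq_intros f1 refl | simp)+
  have d2: "((\<lambda>a. f2 a - (2 * c2 + 6 * c3 * a)) has_real_derivative f3 a - 6 * c3) (at a)" for a
    by (rule derivative_eq_intros f2 refl | simp)+
  have p: "((\<lambda>a. a ^ 3) has_real_derivative 3 * a ^ 2) (at a)"
    "((\<lambda>a. 3 * a ^ 2) has_real_derivative 6 * a ^ 1) (at a)"
    "((\<lambda>a. 6 * a ^ 1) has_real_derivative 6 * a ^ 0) (at a)" for a :: real
    by (rule derivative_eq_intros refl | simp)+
  have z: "((\<lambda>a. k * a ^ n) \<longlongrightarrow> 0) (at_right 0)" if "n > 0" for k :: real and n
    using that by (intro lim) (auto intro!: continuous_intros)
  note ev = always_eventually[OF allI]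
  have h3: "((\<lambda>a. (f3 a - 6 * c3) / (6 * a ^ 0)) \<longlongrightarrow> 0) (at_right 0)"
    by (rule lim) (intro continuous_intros cont, simp_all add: c)
  have h2: "((\<lambda>a. (f2 a - (2 * c2 + 6 * c3 * a)) / (6 * a ^ 1)) \<longlongrightarrow> 0) (at_right 0)"
    by (rule l[OF lim z ne ne ev[OF d2] ev[OF p(3)] h3]) (auto intro!: continuous_intros cont simp: c)
  have h1: "((\<lambda>a. (f1 a - (c1 + 2 * c2 * a + 3 * c3 * a\<^sup>2)) / (3 * a\<^sup>2)) \<longlongrightarrow> 0) (at_right 0)"
    by (rule l[OF lim z ne ne ev[OF d1] ev[OF p(2)] h2]) (auto intro!: continuous_intros cont simp: c)
  show "((\<lambda>a. (f a - (c0 + c1 * a + c2 * a\<^sup>2 + c3 * a ^ 3)) / a ^ 3) \<longlongrightarrow> 0) (at_right 0)"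
    by (rule l[OF lim z[of 3 1, unfolded mult_1] ne[of 1 3, unfolded mult_1] ne ev[OF d0] ev[OF p(1)] h1]) (auto intro!: continuous_intros cont simp: c)
qed

lemma taylor3_const: "taylor3 (\<lambda>_. c) c 0 0 0"
  unfolding taylor3_def by (auto intro!: exI[of _ "\<lambda>_. 0"])

lemma taylor3_add:
  assumes "taylor3 f f0 f1 f2 f3" "taylor3 g g0 g1 g2 g3"
  shows "taylor3 (\<lambda>a. f a + g a) (f0 + g0) (f1 + g1) (f2 + g2) (f3 + g3)"
proof -
  from assms obtain r s where
    r: "\<And>a. a > 0 \<Longrightarrow> f a = f0 + f1 * a + f2 * a\<^sup>2 + f3 * a ^ 3 + a ^ 3 * r a" "(r \<longlongrightarrow> 0) (at_right 0)" and
    s: "\<And>a. a > 0 \<Longrightarrow> g a = g0 + g1 * a + g2 * a\<^sup>2 + g3 * a ^ 3 + a ^ 3 * s a" "(s \<longlongrightarrow> 0) (at_right 0)"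
    unfolding taylor3_def by blast
  show ?thesis
    unfolding taylor3_def
    by (rule exI[of _ "\<lambda>a. r a + s a"])
       (auto simp: r s algebra_simps intro!: tendsto_eq_intros r s)
qed

lemma taylor3_mult:
  assumes "taylor3 f f0 f1 f2 f3" "taylor3 g g0 g1 g2 g3"
  shows "taylor3 (\<lambda>a. f a * g a) (f0 * g0) (f0 * g1 + f1 * g0) (f0 * g2 + f1 * g1 + f2 * g0)
    (f0 * g3 + f1 * g2 + f2 * g1 + f3 * g0)"
proof -
  from assms obtain r s where
    r: "\<And>a. a > 0 \<Longrightarrow> f a = f0 + f1 * a + f2 * a\<^sup>2 + f3 * a ^ 3 + a ^ 3 * r a" "(r \<longlongrightarrow> 0) (at_right 0)" and
    s: "\<And>a. a > 0 \<Longrightarrow> g a = g0 + g1 * a + g2 * a\<^sup>2 + g3 * a ^ 3 + a ^ 3 * s a" "(s \<longlongrightarrow> 0) (at_right 0)"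
    unfolding taylor3_def by blast
  \<comment> \<open>The two remainders times the opposite factors, and in the last line the terms of
    degree 4 to 6 of the polynomial product, all divided by \<open>a ^ 3\<close>.\<close>
  define t where "t a = r a * (g0 + g1 * a + g2 * a\<^sup>2 + g3 * a ^ 3)
     + s a * (f0 + f1 * a + f2 * a\<^sup>2 + f3 * a ^ 3) + a ^ 3 * (r a * s a)
     + a * (f1 * g3 + f2 * g2 + f3 * g1 + a * (f2 * g3 + f3 * g2) + a\<^sup>2 * (f3 * g3))" for a
  have "(t \<longlongrightarrow> 0) (at_right 0)"
    unfolding t_def by (rule tendsto_eq_intros r s refl | simp)+
  moreover have "f a * g a = f0 * g0 + (f0 * g1 + f1 * g0) * a + (f0 * g2 + f1 * g1 + f2 * g0) * a\<^sup>2
      + (f0 * g3 + f1 * g2 + f2 * g1 + f3 * g0) * a ^ 3 + a ^ 3 * t a" if "a > 0" for a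
    unfolding r(1)[OF that] s(1)[OF that] t_def by algebra
  ultimately show ?thesis
    unfolding taylor3_def by blast
qed

lemma taylor3_cong:
  assumes "taylor3 f f0 f1 f2 f3" "\<And>a. a > 0 \<Longrightarrow> f a = g a" "f0 = g0" "f1 = g1" "f2 = g2" "f3 = g3"
  shows "taylor3 g g0 g1 g2 g3"
  using assms unfolding taylor3_def by (metis (lifting))

lemma taylor3_cmult:
  assumes "taylor3 f f0 f1 f2 f3"
  shows "taylor3 (\<lambda>a. c * f a) (c * f0) (c * f1) (c * f2) (c * f3)"
  using taylor3_mult[OF taylor3_const[of c] assms] by simp

lemma taylor3_sum:
  assumes "\<And>l. l \<in> A \<Longrightarrow> taylor3 (f l) (c0 l) (c1 l) (c2 l) (c3 l)"
  shows "taylor3 (\<lambda>a. \<Sum>l\<in>A. f l a) (\<Sum>l\<in>A. c0 l) (\<Sum>l\<in>A. c1 l) (\<Sum>l\<in>A. c2 l) (\<Sum>l\<in>A. c3 l)"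
  using assms
  by (induction A rule: infinite_finite_induct) (auto intro: taylor3_const taylor3_add)

section \<open>Composition with the logarithm\<close>

lemma ln_add_one_remainder:
  "((\<lambda>x::real. (ln (1 + x) - x + x\<^sup>2 / 2 - x ^ 3 / 3) / x ^ 3) \<longlongrightarrow> 0) (at 0)"
  unfolding filterlim_at_split
  by (intro conjI; real_asymp)

lemma taylor3_ln:
  assumes "taylor3 f 1 x1 x2 x3"
  shows "taylor3 (\<lambda>a. ln (f a)) 0 x1 (x2 - x1\<^sup>2 / 2) (x3 - x1 * x2 + x1 ^ 3 / 3)"
proof -
  define x where "x a = f a - 1" for a
  \<comment> \<open>The value 0 at \<open>y = 0\<close> makes \<open>e\<close> continuous there;
    this matters because \<open>f a\<close> may equal 1 for some positive \<open>a\<close>.\<close>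
  define e where "e y = (if y = 0 then 0 else (ln (1 + y) - y + y\<^sup>2 / 2 - y ^ 3 / 3) / y ^ 3)" for y :: real
  have e: "ln (1 + y) = y - y\<^sup>2 / 2 + y ^ 3 / 3 + y ^ 3 * e y" for y
    by (simp add: e_def)
  have elim: "(e \<longlongrightarrow> 0) (at 0)"
    using ln_add_one_remainder
    by (rule Lim_transform_eventually) (auto simp: e_def eventually_at_filter)
  have e0: "e 0 = 0"
    by (simp add: e_def)
  have "isCont e 0"
    using elim by (simp add: isCont_def e_def)
  have x: "taylor3 x 0 x1 x2 x3"
    using taylor3_add[OF assms taylor3_const[of "- 1"]] by (simp add: x_def[abs_def])
  then obtain r where
    r: "\<And>a. a > 0 \<Longrightarrow> x a = x1 * a + x2 * a\<^sup>2 + x3 * a ^ 3 + a ^ 3 * r a" "(r \<longlongrightarrow> 0) (at_right 0)"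
    unfolding taylor3_def by auto
  \<comment> \<open>With \<open>x a = a * q a\<close> and \<open>q\<close> convergent, the
    logarithmic remainder \<open>x a ^ 3 * e (x a)\<close> is visibly \<open>a ^ 3\<close> times a
    null function.\<close>
  define q where "q a = x1 + x2 * a + x3 * a\<^sup>2 + a\<^sup>2 * r a" for a
  have q: "x a = a * q a" if "a > 0" for a
    unfolding r(1)[OF that] q_def by algebra
  have qlim: "(q \<longlongrightarrow> x1) (at_right 0)"
    unfolding q_def by (rule tendsto_eq_intros r refl | simp)+
  have "((\<lambda>a. a * q a) \<longlongrightarrow> 0) (at_right 0)"
    by (rule tendsto_eq_intros qlim refl | simp)+
  then have xlim: "((\<lambda>a. e (a * q a)) \<longlongrightarrow> 0) (at_right 0)"
    using isCont_tendsto_compose[OF \<open>isCont e 0\<close>, unfolded e0] by blast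
  have rem: "taylor3 (\<lambda>a. x a ^ 3 * e (x a)) 0 0 0 0"
    unfolding taylor3_def
  proof (intro exI conjI allI impI)
    show "((\<lambda>a. q a ^ 3 * e (a * q a)) \<longlongrightarrow> 0) (at_right 0)"
      by (rule tendsto_eq_intros qlim xlim refl | simp)+
  qed (simp add: q power_mult_distrib)
  note x2 = taylor3_mult[OF x x]
  note x3 = taylor3_mult[OF x x2]
  show ?thesis
    by (rule taylor3_cong[OF taylor3_add[OF taylor3_add[OF x taylor3_cmult[OF x2, of "- 1 / 2"]]
          taylor3_add[OF taylor3_cmult[OF x3, of "1 / 3"] rem]]])
       (use e[of "x a" for a] in \<open>simp_all add: x_def power2_eq_square power3_eq_cube\<close>)
qed

text \<open>The coefficients of order 0, 1 and 2 in the expansion of \<open>edge_flux \<beta>\<close> at 0.\<close>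

definition edge_moment :: "nat \<Rightarrow> real \<Rightarrow> real" where
  "edge_moment k \<beta> = (if k = 0 then sin \<beta> / (2 * sqrt pi) else if k = 1 then sin \<beta> * cos \<beta> / pi
     else - (sin \<beta> ^ 3) / (2 * sqrt pi))"

lemma edge_flux_derivs:
  obtains f1 f2 f3 where
    "\<And>a. (edge_flux \<beta> has_real_derivative f1 a) (at a)"
    "\<And>a. (f1 has_real_derivative f2 a) (at a)"
    "\<And>a. (f2 has_real_derivative f3 a) (at a)"
    "\<And>a. isCont f3 a"
    "edge_flux \<beta> 0 = edge_moment 0 \<beta>" "f1 0 = edge_moment 1 \<beta>" "f2 0 / 2 = edge_moment 2 \<beta>"
proof -
  define c where "c = cos \<beta>"
  define x where "x a = exp (- a\<^sup>2)" for a :: real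
  define e where "e a = x a * mills (a * c)" for a
  \<comment> \<open>The equation for \<open>mills\<close> gives \<open>e\<close> a linear
    first-order equation in \<open>a\<close>, so each derivative is expressed through the previous
    ones.\<close>
  define e1 where "e1 a = 2 * a * (c\<^sup>2 - 1) * e a + c * x a" for a
  define e2 where "e2 a = 2 * (c\<^sup>2 - 1) * e a + 2 * a * (c\<^sup>2 - 1) * e1 a - 2 * a * c * x a" for a
  define e3 where "e3 a = 4 * (c\<^sup>2 - 1) * e1 a + 2 * a * (c\<^sup>2 - 1) * e2 a - 2 * c * x a + 4 * a\<^sup>2 * c * x a" for a
  have dx: "(x has_real_derivative - 2 * a * x a) (at a)" for a
    unfolding x_def by (rule derivative_eq_intros refl | simp)+
  have de: "(e has_real_derivative e1 a) (at a)" for a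
    unfolding e_def[abs_def] e1_def
    by (rule derivative_eq_intros DERIV_mills_chain dx refl | simp add: algebra_simps power2_eq_square)+
  have de1: "(e1 has_real_derivative e2 a) (at a)" for a
    unfolding e1_def[abs_def] e2_def
    by (rule derivative_eq_intros de[unfolded e1_def] dx refl | simp add: algebra_simps power2_eq_square e1_def)+
  have de2: "(e2 has_real_derivative e3 a) (at a)" for a
    unfolding e2_def[abs_def] e3_def
    by (rule derivative_eq_intros de de1[unfolded e2_def] dx refl | simp add: algebra_simps power2_eq_square e2_def)+
  have flux: "edge_flux \<beta> = (\<lambda>a. sin \<beta> / pi * e a)"
    by (simp add: fun_eq_iff edge_flux_def e_def x_def c_def)
  have c2: "c\<^sup>2 - 1 = - (sin \<beta>)\<^sup>2"
    by (simp add: c_def cos_squared_eq)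
  show thesis
  proof
    show "(edge_flux \<beta> has_real_derivative sin \<beta> / pi * e1 a) (at a)" for a
      unfolding flux by (rule DERIV_cmult de)+
    show "((\<lambda>a. sin \<beta> / pi * e1 a) has_real_derivative sin \<beta> / pi * e2 a) (at a)" for a
      by (rule DERIV_cmult de1)+
    show "((\<lambda>a. sin \<beta> / pi * e2 a) has_real_derivative sin \<beta> / pi * e3 a) (at a)" for a
      by (rule DERIV_cmult de2)+
    show "isCont (\<lambda>a. sin \<beta> / pi * e3 a) a" for a
      unfolding e3_def
      by (intro continuous_intros DERIV_isCont[OF dx] DERIV_isCont[OF de1] DERIV_isCont[OF de2])
    have sp: "sqrt pi / (pi * 2) = 1 / (sqrt pi * 2)"
      by (simp add: field_simps)
    have e0: "e 0 = sqrt pi / 2" by (simp add: e_def x_def)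
    show "edge_flux \<beta> 0 = edge_moment 0 \<beta>"
      by (simp add: flux e0 edge_moment_def field_simps)
    show "sin \<beta> / pi * e1 0 = edge_moment 1 \<beta>"
      by (simp add: e1_def x_def c_def edge_moment_def)
    have "e2 0 = - ((sin \<beta>)\<^sup>2 * sqrt pi)"
      by (simp add: e2_def c2 e0)
    then have "sin \<beta> / pi * e2 0 / 2 = - (sin \<beta> ^ 3) * (sqrt pi / (pi * 2))"
      by (simp add: power2_eq_square power3_eq_cube)
    then show "sin \<beta> / pi * e2 0 / 2 = edge_moment 2 \<beta>"
      unfolding sp by (simp add: edge_moment_def field_simps)
  qed
qed

text \<open>The probability has the flux difference as derivative, so its coefficients are those of
  the flux divided by 1, 2 and 3. The cubic flux coefficient may stay anonymous: it will only meet
  the vanishing constant term of a logarithm.\<close>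

lemma taylor3_edge_flux_diff:
  assumes "\<alpha> \<ge> 0"
  shows "\<exists>c. taylor3 (\<lambda>a. edge_flux (\<phi> + \<alpha>) a - edge_flux (\<phi> - \<alpha>) a)
      (edge_moment 0 (\<phi> + \<alpha>) - edge_moment 0 (\<phi> - \<alpha>))
      (edge_moment 1 (\<phi> + \<alpha>) - edge_moment 1 (\<phi> - \<alpha>))
      (edge_moment 2 (\<phi> + \<alpha>) - edge_moment 2 (\<phi> - \<alpha>)) c" (is ?flux)
    and "taylor3 (wedge_prob \<alpha> \<phi>) (\<alpha> / pi)
      (edge_moment 0 (\<phi> + \<alpha>) - edge_moment 0 (\<phi> - \<alpha>))
      ((edge_moment 1 (\<phi> + \<alpha>) - edge_moment 1 (\<phi> - \<alpha>)) / 2)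
      ((edge_moment 2 (\<phi> + \<alpha>) - edge_moment 2 (\<phi> - \<alpha>)) / 3)" (is ?prob)
proof -
  obtain f1 f2 f3 where f:
    "\<And>a. (edge_flux (\<phi> + \<alpha>) has_real_derivative f1 a) (at a)"
    "\<And>a. (f1 has_real_derivative f2 a) (at a)"
    "\<And>a. (f2 has_real_derivative f3 a) (at a)"
    "\<And>a. isCont f3 a"
    "edge_flux (\<phi> + \<alpha>) 0 = edge_moment 0 (\<phi> + \<alpha>)" "f1 0 = edge_moment 1 (\<phi> + \<alpha>)" "f2 0 / 2 = edge_moment 2 (\<phi> + \<alpha>)"
    by (rule edge_flux_derivs[of "\<phi> + \<alpha>"], rule that, assumption+)
  obtain g1 g2 g3 where g:
    "\<And>a. (edge_flux (\<phi> - \<alpha>) has_real_derivative g1 a) (at a)"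
    "\<And>a. (g1 has_real_derivative g2 a) (at a)"
    "\<And>a. (g2 has_real_derivative g3 a) (at a)"
    "\<And>a. isCont g3 a"
    "edge_flux (\<phi> - \<alpha>) 0 = edge_moment 0 (\<phi> - \<alpha>)" "g1 0 = edge_moment 1 (\<phi> - \<alpha>)" "g2 0 / 2 = edge_moment 2 (\<phi> - \<alpha>)"
    by (rule edge_flux_derivs[of "\<phi> - \<alpha>"], rule that, assumption+)
  note d1 = DERIV_diff[OF f(1) g(1)] and d2 = DERIV_diff[OF f(2) g(2)] and d3 = DERIV_diff[OF f(3) g(3)]
  show ?flux
    by (rule exI, rule taylor3_derivs[OF d1 d2 d3 continuous_diff[OF f(4) g(4)] _ _ _ refl])
       (simp_all flip: f(5-) g(5-) add: diff_divide_distrib del: One_nat_def)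
  show ?prob
    by (rule taylor3_derivs[OF DERIV_wedge_prob[OF assms] d1 d2 DERIV_isCont[OF d3]])
       (simp_all flip: f(5-) g(5-) add: wedge_prob_0 assms diff_divide_distrib del: One_nat_def)
qed

section \<open>Expansion of the entropy\<close>

text \<open>Despite the name this is the mutual information, \<open>ln M\<close> minus the output
  entropy. Unlike the SNR, the variable \<open>a\<close> leaves it differentiable through 0.\<close>

definition psk_entropy :: "nat \<Rightarrow> real \<Rightarrow> real" where
  "psk_entropy M a = ln (real M) + (\<Sum>l<M. wedge_prob (pi / M) (2 * pi * real l / real M) a *
     ln (wedge_prob (pi / M) (2 * pi * real l / real M) a))"

text \<open>The factor \<open>M\<close> inside the logarithm makes its argument 1 at
  \<open>a = 0\<close>; its contribution is \<open>ln M\<close> times the total flux, which is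
  0.\<close>

definition psk_entropy' :: "nat \<Rightarrow> real \<Rightarrow> real" where
  "psk_entropy' M a = (\<Sum>l<M. (edge_flux (2 * pi * real l / real M + pi / M) a - edge_flux (2 * pi * real l / real M - pi / M) a) *
     ln (real M * wedge_prob (pi / M) (2 * pi * real l / real M) a))"

text \<open>Neighbouring wedges share a ray, so the fluxes telescope around the circle: total
  probability is conserved.\<close>

lemma sum_edge_flux_diff:
  assumes "M > 0"
  shows "(\<Sum>l<M. edge_flux (2 * pi * real l / real M + pi / M) a - edge_flux (2 * pi * real l / real M - pi / M) a) = 0"
proof -
  define g where "g l = edge_flux (2 * pi * real l / real M - pi / M) a" for l :: nat
  have "(\<Sum>l<M. edge_flux (2 * pi * real l / real M + pi / M) a - edge_flux (2 * pi * real l / real M - pi / M) a)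
      = (\<Sum>l<M. g (Suc l) - g l)"
    by (simp add: g_def algebra_simps add_divide_distrib)
  also have "\<dots> = g M - g 0"
    by (rule sum_lessThan_telescope)
  \<comment> \<open>After a full turn the last upper ray is the first lower ray.\<close>
  also have "g M = g 0"
    using assms by (simp add: g_def edge_flux_def sin_diff cos_diff)
  finally show ?thesis by simp
qed

lemma psk_entropy_0: "M > 0 \<Longrightarrow> psk_entropy M 0 = 0"
  by (simp add: psk_entropy_def wedge_prob_0 ln_div)

lemma DERIV_psk_entropy:
  assumes "M > 0"
  shows "(psk_entropy M has_real_derivative psk_entropy' M a) (at a)"
proof -
  define Q where "Q l a = wedge_prob (pi / M) (2 * pi * real l / real M) a" for l :: nat and a
  define R where "R l a = edge_flux (2 * pi * real l / real M + pi / M) a - edge_flux (2 * pi * real l / real M - pi / M) a"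
    for l :: nat and a
  have pos: "Q l a > 0" for l a
    using assms by (simp add: Q_def wedge_prob_pos)
  have dQ: "(Q l has_real_derivative R l a) (at a)" for l a
    unfolding Q_def[abs_def] R_def by (rule DERIV_wedge_prob) simp
  have "((\<lambda>a. ln (real M) + (\<Sum>l<M. Q l a * ln (Q l a))) has_real_derivative
      0 + (\<Sum>l<M. R l a * ln (Q l a) + 1 / Q l a * R l a * Q l a)) (at a)"
    by (intro DERIV_add DERIV_const DERIV_sum DERIV_mult dQ DERIV_chain2[OF DERIV_ln_divide dQ]) (use pos in auto)
  also have "0 + (\<Sum>l<M. R l a * ln (Q l a) + 1 / Q l a * R l a * Q l a) = (\<Sum>l<M. R l a * ln (Q l a)) + (\<Sum>l<M. R l a)"
    using pos by (simp add: sum.distrib less_imp_neq[symmetric])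
  \<comment> \<open>Both extra sums are 0: the one left by differentiating the logarithms is
    exchanged for the one that puts \<open>M\<close> inside them.\<close>
  also have "\<dots> = (\<Sum>l<M. R l a * ln (Q l a)) + ln (real M) * (\<Sum>l<M. R l a)"
    using sum_edge_flux_diff[OF assms, of a] by (simp add: R_def)
  also have "\<dots> = (\<Sum>l<M. R l a * ln (real M * Q l a))"
  proof -
    have "ln (real M * Q l a) = ln (real M) + ln (Q l a)" for l
      using pos[of l a] assms by (simp add: ln_mult)
    then show ?thesis by (simp add: algebra_simps sum.distrib sum_distrib_left)
  qed
  finally show ?thesis
    by (simp add: psk_entropy_def[abs_def] psk_entropy'_def Q_def R_def)
qed

lemma taylor3_psk_entropy':
  fixes M :: nat
  defines "q \<equiv> \<lambda>k l. edge_moment k (2 * pi * real l / real M + pi / M) - edge_moment k (2 * pi * real l / real M - pi / M)"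
  assumes "M > 0"
  shows "taylor3 (psk_entropy' M) 0 (\<Sum>l<M. real M * (q 0 l)\<^sup>2)
    (\<Sum>l<M. 3 * real M / 2 * (q 0 l * q 1 l) - (real M)\<^sup>2 / 2 * q 0 l ^ 3)
    (\<Sum>l<M. 4 * real M / 3 * (q 0 l * q 2 l) + real M / 2 * (q 1 l)\<^sup>2 - (real M)\<^sup>2 * ((q 0 l)\<^sup>2 * q 1 l) + real M ^ 3 / 3 * q 0 l ^ 4)"
proof -
  have t: "taylor3 (\<lambda>a. (edge_flux (2 * pi * real l / real M + pi / M) a - edge_flux (2 * pi * real l / real M - pi / M) a) *
       ln (real M * wedge_prob (pi / M) (2 * pi * real l / real M) a)) 0 (real M * (q 0 l)\<^sup>2)
    (3 * real M / 2 * (q 0 l * q 1 l) - (real M)\<^sup>2 / 2 * q 0 l ^ 3)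
    (4 * real M / 3 * (q 0 l * q 2 l) + real M / 2 * (q 1 l)\<^sup>2 - (real M)\<^sup>2 * ((q 0 l)\<^sup>2 * q 1 l) + real M ^ 3 / 3 * q 0 l ^ 4)" for l
  proof -
    have "pi / real M \<ge> 0" by simp
    note exp = taylor3_edge_flux_diff[OF this, of "2 * pi * real l / real M"]
    obtain c where f: "taylor3 (\<lambda>a. edge_flux (2 * pi * real l / real M + pi / M) a -
        edge_flux (2 * pi * real l / real M - pi / M) a) (q 0 l) (q 1 l) (q 2 l) c"
      using exp(1) unfolding q_def by blast
    have "taylor3 (\<lambda>a. real M * wedge_prob (pi / M) (2 * pi * real l / real M) a) 1
        (real M * q 0 l) (real M * (q 1 l / 2)) (real M * (q 2 l / 3))"
      using taylor3_cmult[OF exp(2), of "real M"] assms by (simp add: q_def)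
    \<comment> \<open>The logarithm has constant term 0, so the unknown \<open>c\<close> drops out
      of the product.\<close>
    from taylor3_mult[OF f taylor3_ln[OF this]]
    show ?thesis
      by (rule taylor3_cong) (simp_all add: field_simps power2_eq_square power3_eq_cube power4_eq_xxxx)
  qed
  have "taylor3 (psk_entropy' M) (\<Sum>l<M. 0) (\<Sum>l<M. real M * (q 0 l)\<^sup>2)
    (\<Sum>l<M. 3 * real M / 2 * (q 0 l * q 1 l) - (real M)\<^sup>2 / 2 * q 0 l ^ 3)
    (\<Sum>l<M. 4 * real M / 3 * (q 0 l * q 2 l) + real M / 2 * (q 1 l)\<^sup>2 - (real M)\<^sup>2 * ((q 0 l)\<^sup>2 * q 1 l) + real M ^ 3 / 3 * q 0 l ^ 4)"
    unfolding psk_entropy'_def[abs_def] by (rule taylor3_sum) (rule t)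
  then show ?thesis by simp
qed

section \<open>Trigonometric sums over the constellation\<close>

lemma sum_cos_multiples_eq_0:
  assumes "M > 0" and s: "sin (pi * real j / real M) \<noteq> 0"
  shows "(\<Sum>l<M. cos (real j * (2 * pi * real l / real M))) = 0"
proof -
  define g where "g l = sin (2 * pi * real j * real l / real M - pi * real j / real M)" for l :: nat
  \<comment> \<open>Multiplication by \<open>2 * sin (pi * j / M)\<close> turns each cosine into a
    difference of sines half a step to either side, and the sum telescopes.\<close>
  have "2 * sin (pi * real j / real M) * (\<Sum>l<M. cos (real j * (2 * pi * real l / real M))) = (\<Sum>l<M. g (Suc l) - g l)"
    unfolding sum_distrib_left
  proof (rule sum.cong[OF refl])
    fix l
    have "g (Suc l) = sin (real j * (2 * pi * real l / real M) + pi * real j / real M)"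
      "g l = sin (real j * (2 * pi * real l / real M) - pi * real j / real M)"
      by (simp_all add: g_def algebra_simps add_divide_distrib)
    then show "2 * sin (pi * real j / real M) * cos (real j * (2 * pi * real l / real M)) = g (Suc l) - g l"
      by (simp add: sin_add sin_diff)
  qed
  also have "\<dots> = g M - g 0"
    by (rule sum_lessThan_telescope)
  also have "g M = g 0"
  proof -
    have "sin (2 * pi * real j) = 0" "cos (2 * pi * real j) = 1"
      using sin_int_2pin[of "int j"] cos_int_2pin[of "int j"] by auto
    then show ?thesis
      using assms by (simp add: g_def sin_diff)
  qed
  finally show ?thesis using s by simp
qed

lemma sum_cos_multiples_eq_M:
  assumes "M > 0" and "M dvd j"
  shows "(\<Sum>l<M. cos (real j * (2 * pi * real l / real M))) = real M"
proof -
  obtain k where "j = M * k" using assms by auto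
  then have "cos (real j * (2 * pi * real l / real M)) = 1" for l
    using assms cos_int_2pin[of "int (k * l)"] by (simp add: mult_ac)
  then show ?thesis by simp
qed

lemma sin_cube: "sin x ^ 3 = (3 * sin x - sin (3 * x)) / 4" for x :: real
proof -
  have "sin (2 * x + x) = 3 * sin x - 4 * sin x ^ 3"
    unfolding sin_add sin_double cos_double_sin
    using sin_cos_squared_add[of x] by algebra
  then show ?thesis by simp
qed

text \<open>Written with sines of multiples of the angle, the moments separate into factors in
  \<open>\<alpha>\<close> and harmonics of order 1 to 3 in \<open>\<phi>\<close>. The products in
  the entropy coefficients then involve harmonics up to order 4.\<close>

lemma edge_moment_diff:
  "edge_moment 0 (\<phi> + \<alpha>) - edge_moment 0 (\<phi> - \<alpha>) = sin \<alpha> / sqrt pi * cos \<phi>"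
  "edge_moment 1 (\<phi> + \<alpha>) - edge_moment 1 (\<phi> - \<alpha>) = sin (2 * \<alpha>) / pi * cos (2 * \<phi>)"
  "edge_moment 2 (\<phi> + \<alpha>) - edge_moment 2 (\<phi> - \<alpha>) =
    - (3 * sin \<alpha> * cos \<phi> - sin (3 * \<alpha>) * cos (3 * \<phi>)) / (4 * sqrt pi)"
proof -
  have d: "sin (x + y) - sin (x - y) = 2 * sin y * cos x" for x y :: real
    by (simp add: sin_add sin_diff)
  show "edge_moment 0 (\<phi> + \<alpha>) - edge_moment 0 (\<phi> - \<alpha>) = sin \<alpha> / sqrt pi * cos \<phi>"
    using d[of \<phi> \<alpha>] by (simp add: edge_moment_def flip: diff_divide_distrib)
  have "edge_moment 1 x = sin (2 * x) / (2 * pi)" for x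
    by (simp add: edge_moment_def sin_double)
  moreover have "2 * (\<phi> + \<alpha>) = 2 * \<phi> + 2 * \<alpha>" "2 * (\<phi> - \<alpha>) = 2 * \<phi> - 2 * \<alpha>"
    by simp_all
  ultimately show "edge_moment 1 (\<phi> + \<alpha>) - edge_moment 1 (\<phi> - \<alpha>) = sin (2 * \<alpha>) / pi * cos (2 * \<phi>)"
    using d[of "2 * \<phi>" "2 * \<alpha>"] by (simp flip: diff_divide_distrib)
  have moment2: "edge_moment 2 x = - (3 * sin x - sin (3 * x)) / (8 * sqrt pi)" for x
    by (simp add: edge_moment_def sin_cube field_simps)
  show "edge_moment 2 (\<phi> + \<alpha>) - edge_moment 2 (\<phi> - \<alpha>) =
    - (3 * sin \<alpha> * cos \<phi> - sin (3 * \<alpha>) * cos (3 * \<phi>)) / (4 * sqrt pi)"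
    using d[of \<phi> \<alpha>] d[of "3 * \<phi>" "3 * \<alpha>"] unfolding moment2 by (simp add: field_simps)
qed

text \<open>
  \<open>X j\<close> is \<open>M\<close> if \<open>M\<close> divides \<open>j\<close> and 0 otherwise; keeping these sums symbolic covers the
  generic case and the exceptional values \<open>M = 2, 3, 4\<close> with one formula.
\<close>

lemma psk_entropy_coeffs:
  fixes M :: nat
  defines "X \<equiv> \<lambda>j. \<Sum>l<M. cos (real j * (2 * pi * real l / real M))"
    and "S \<equiv> sin (pi / M)" and "S2 \<equiv> sin (2 * (pi / M))" and "S3 \<equiv> sin (3 * (pi / M))"
  assumes "M > 0"
  shows "taylor3 (psk_entropy' M) 0
    (real M * S\<^sup>2 / pi * ((real M + X 2) / 2))
    (3 * real M / 2 * (S * S2 / (pi * sqrt pi)) * ((X 1 + X 3) / 2)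
      - (real M)\<^sup>2 / 2 * (S ^ 3 / (pi * sqrt pi)) * ((3 * X 1 + X 3) / 4))
    (- (real M * S / (3 * pi)) * (3 * S * ((real M + X 2) / 2) - S3 * ((X 4 + X 2) / 2))
      + real M / 2 * (S2\<^sup>2 / pi\<^sup>2) * ((real M + X 4) / 2)
      - (real M)\<^sup>2 * (S\<^sup>2 * S2 / pi\<^sup>2) * ((real M + 2 * X 2 + X 4) / 4)
      + real M ^ 3 / 3 * (S ^ 4 / pi\<^sup>2) * ((3 * real M + 4 * X 2 + X 4) / 8))"
proof -
  define c where "c j l = cos (real j * (2 * pi * real l / real M))" for j l :: nat
  define q where "q k l = edge_moment k (2 * pi * real l / real M + pi / M) - edge_moment k (2 * pi * real l / real M - pi / M)"
    for k and l :: nat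
  have X: "X j = (\<Sum>l<M. c j l)" for j
    by (simp add: X_def c_def)
  have q: "q 0 l = S / sqrt pi * c 1 l" "q 1 l = S2 / pi * c 2 l"
    "q 2 l = - (3 * S * c 1 l - S3 * c 3 l) / (4 * sqrt pi)" for l
    unfolding q_def edge_moment_diff by (simp_all add: S_def S2_def S3_def c_def)
  \<comment> \<open>Each \<open>c j l\<close> is a Chebyshev polynomial in \<open>c 1 l\<close>, so
    the product-to-sum rules used below become polynomial identities.\<close>
  have c2: "c 2 l = 2 * (c 1 l)\<^sup>2 - 1" for l
    using cos_double_cos[of "2 * pi * real l / real M"] by (simp add: c_def)
  have c3: "c 3 l = 4 * c 1 l ^ 3 - 3 * c 1 l" for l
    using cos_treble_cos[of "2 * pi * real l / real M"] by (simp add: c_def)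
  have c4: "c 4 l = 8 * c 1 l ^ 4 - 8 * (c 1 l)\<^sup>2 + 1" for l
  proof -
    have "c 4 l = 2 * (c 2 l)\<^sup>2 - 1"
      using cos_double_cos[of "2 * (2 * pi * real l / real M)"] by (simp add: c_def)
    then show ?thesis unfolding c2 by algebra
  qed
  have r: "sqrt pi ^ 2 = pi" "sqrt pi ^ 3 = pi * sqrt pi" "sqrt pi ^ 4 = pi\<^sup>2"
    by (simp_all add: power3_eq_cube power4_eq_xxxx power2_eq_square)
  have sums: "(\<Sum>l<M. a * p l) = a * (\<Sum>l<M. p l)" for a and p :: "nat \<Rightarrow> real"
    by (simp add: sum_distrib_left)
  have A: "(\<Sum>l<M. real M * (q 0 l)\<^sup>2) = real M * S\<^sup>2 / pi * ((real M + X 2) / 2)"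
  proof -
    have "(\<Sum>l<M. real M * (q 0 l)\<^sup>2) = (\<Sum>l<M. real M * S\<^sup>2 / pi * ((1 + c 2 l) / 2))"
      by (intro sum.cong refl) (unfold q c2, simp add: power_mult_distrib power_divide)
    then show ?thesis
      by (simp add: sums X sum.distrib flip: sum_divide_distrib sum_distrib_left)
  qed
  have B: "(\<Sum>l<M. 3 * real M / 2 * (q 0 l * q 1 l) - (real M)\<^sup>2 / 2 * q 0 l ^ 3) =
    3 * real M / 2 * (S * S2 / (pi * sqrt pi)) * ((X 1 + X 3) / 2)
      - (real M)\<^sup>2 / 2 * (S ^ 3 / (pi * sqrt pi)) * ((3 * X 1 + X 3) / 4)"
  proof -
    have "(\<Sum>l<M. 3 * real M / 2 * (q 0 l * q 1 l) - (real M)\<^sup>2 / 2 * q 0 l ^ 3) =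
      (\<Sum>l<M. 3 * real M / 2 * (S * S2 / (pi * sqrt pi)) * ((c 1 l + c 3 l) / 2)
      - (real M)\<^sup>2 / 2 * (S ^ 3 / (pi * sqrt pi)) * ((3 * c 1 l + c 3 l) / 4))"
    proof (intro sum.cong refl)
      fix l
      have "q 0 l * q 1 l = S * S2 / (pi * sqrt pi) * ((c 1 l + c 3 l) / 2)"
        unfolding q c2 c3 by (simp add: power2_eq_square power3_eq_cube field_simps)
      moreover have "q 0 l ^ 3 = S ^ 3 / (pi * sqrt pi) * ((3 * c 1 l + c 3 l) / 4)"
        unfolding q c3 by (simp add: power_mult_distrib power_divide r)
      ultimately show "3 * real M / 2 * (q 0 l * q 1 l) - (real M)\<^sup>2 / 2 * q 0 l ^ 3 =
        3 * real M / 2 * (S * S2 / (pi * sqrt pi)) * ((c 1 l + c 3 l) / 2)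
        - (real M)\<^sup>2 / 2 * (S ^ 3 / (pi * sqrt pi)) * ((3 * c 1 l + c 3 l) / 4)"
        by (simp only: mult.assoc)
    qed
    then show ?thesis
      by (simp add: sums X sum.distrib sum_subtractf flip: sum_divide_distrib sum_distrib_left)
  qed
  have C: "(\<Sum>l<M. 4 * real M / 3 * (q 0 l * q 2 l) + real M / 2 * (q 1 l)\<^sup>2 - (real M)\<^sup>2 * ((q 0 l)\<^sup>2 * q 1 l) + real M ^ 3 / 3 * q 0 l ^ 4)
    = - (real M * S / (3 * pi)) * (3 * S * ((real M + X 2) / 2) - S3 * ((X 4 + X 2) / 2))
      + real M / 2 * (S2\<^sup>2 / pi\<^sup>2) * ((real M + X 4) / 2)
      - (real M)\<^sup>2 * (S\<^sup>2 * S2 / pi\<^sup>2) * ((real M + 2 * X 2 + X 4) / 4)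
      + real M ^ 3 / 3 * (S ^ 4 / pi\<^sup>2) * ((3 * real M + 4 * X 2 + X 4) / 8)"
  proof -
    have "(\<Sum>l<M. 4 * real M / 3 * (q 0 l * q 2 l) + real M / 2 * (q 1 l)\<^sup>2 - (real M)\<^sup>2 * ((q 0 l)\<^sup>2 * q 1 l) + real M ^ 3 / 3 * q 0 l ^ 4) =
      (\<Sum>l<M. - (real M * S / (3 * pi)) * (3 * S * ((1 + c 2 l) / 2) - S3 * ((c 4 l + c 2 l) / 2))
      + real M / 2 * (S2\<^sup>2 / pi\<^sup>2) * ((1 + c 4 l) / 2)
      - (real M)\<^sup>2 * (S\<^sup>2 * S2 / pi\<^sup>2) * ((1 + 2 * c 2 l + c 4 l) / 4)
      + real M ^ 3 / 3 * (S ^ 4 / pi\<^sup>2) * ((3 + 4 * c 2 l + c 4 l) / 8))"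
    proof (intro sum.cong refl)
      fix l
      have 1: "q 0 l * q 2 l = - (S / (4 * pi)) * (3 * S * ((1 + c 2 l) / 2) - S3 * ((c 4 l + c 2 l) / 2))"
      proof -
        have "(S / t * y) * (- x / (4 * t)) = - (S / (4 * t\<^sup>2)) * (y * x)" for t x y
          by (simp add: power2_eq_square)
        from this[of "sqrt pi"] have "q 0 l * q 2 l = - (S / (4 * pi)) * (c 1 l * (3 * S * c 1 l - S3 * c 3 l))"
          unfolding q r .
        also have "c 1 l * (3 * S * c 1 l - S3 * c 3 l) = 3 * S * (c 1 l)\<^sup>2 - S3 * (c 3 l * c 1 l)"
          by algebra
        also have "(c 1 l)\<^sup>2 = (1 + c 2 l) / 2" by (simp add: c2)
        also have "c 3 l * c 1 l = (c 4 l + c 2 l) / 2"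
          by (simp add: c2 c3 c4 power2_eq_square power3_eq_cube power4_eq_xxxx algebra_simps)
        finally show ?thesis .
      qed
      have lead: "4 * real M / 3 * (q 0 l * q 2 l) =
          - (real M * S / (3 * pi)) * (3 * S * ((1 + c 2 l) / 2) - S3 * ((c 4 l + c 2 l) / 2))"
        unfolding 1 by simp
      have 2: "(q 1 l)\<^sup>2 = S2\<^sup>2 / pi\<^sup>2 * ((1 + c 4 l) / 2)"
      proof -
        have "(c 2 l)\<^sup>2 = (1 + c 4 l) / 2" unfolding c2 c4 by algebra
        then show ?thesis by (simp only: q power_mult_distrib power_divide)
      qed
      have 3: "(q 0 l)\<^sup>2 * q 1 l = S\<^sup>2 * S2 / pi\<^sup>2 * ((1 + 2 * c 2 l + c 4 l) / 4)"
      proof -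
        have "(c 1 l)\<^sup>2 * c 2 l = (1 + 2 * c 2 l + c 4 l) / 4" unfolding c2 c4 by algebra
        moreover have "(q 0 l)\<^sup>2 * q 1 l = S\<^sup>2 * S2 / (pi * pi) * ((c 1 l)\<^sup>2 * c 2 l)"
          unfolding q by (simp add: power_mult_distrib power_divide)
        ultimately show ?thesis by (simp only: power2_eq_square times_divide_eq_right times_divide_eq_left mult.assoc)
      qed
      have 4: "q 0 l ^ 4 = S ^ 4 / pi\<^sup>2 * ((3 + 4 * c 2 l + c 4 l) / 8)"
        unfolding q c2 c4 by (simp add: power_mult_distrib power_divide r)
      show "4 * real M / 3 * (q 0 l * q 2 l) + real M / 2 * (q 1 l)\<^sup>2 - (real M)\<^sup>2 * ((q 0 l)\<^sup>2 * q 1 l) + real M ^ 3 / 3 * q 0 l ^ 4 =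
        - (real M * S / (3 * pi)) * (3 * S * ((1 + c 2 l) / 2) - S3 * ((c 4 l + c 2 l) / 2))
      + real M / 2 * (S2\<^sup>2 / pi\<^sup>2) * ((1 + c 4 l) / 2)
      - (real M)\<^sup>2 * (S\<^sup>2 * S2 / pi\<^sup>2) * ((1 + 2 * c 2 l + c 4 l) / 4)
      + real M ^ 3 / 3 * (S ^ 4 / pi\<^sup>2) * ((3 + 4 * c 2 l + c 4 l) / 8)"
        unfolding lead 2 3 4 by (simp only: mult.assoc)
    qed
    then show ?thesis
      by (simp add: sums X sum.distrib sum_subtractf flip: sum_divide_distrib sum_distrib_left)
  qed
  show ?thesis
    using taylor3_psk_entropy'[OF \<open>M > 0\<close>] unfolding q_def[symmetric] A B C .
qed

section \<open>Behaviour at low SNR\<close>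

lemma right_deriv_eqI:
  assumes "(f has_real_derivative D) (at_right x)"
  shows "right_deriv f x = D"
  unfolding right_deriv_def
  using assms by (intro tendsto_Lim) (simp_all add: has_field_derivative_iff)

text \<open>The finite second-order limit has two sources: the cubic coefficient \<open>G\<close>,
  and the factor \<open>1 / (1 + v * s)^2\<close> from differentiating the argument of the root,
  whose slope \<open>- 2 * v\<close> at 0 acts on the leading coefficient \<open>A\<close>.\<close>

lemma right_derivs_sqrt_reparam:
  fixes C E E' :: "real \<Rightarrow> real" and A B G D v :: real
  assumes D: "D > 0" and v: "v \<ge> 0"
    and C: "\<And>s. s \<ge> 0 \<Longrightarrow> C s = E (sqrt (D * (s / (1 + v * s))))"
    and E: "\<And>a. (E has_real_derivative E' a) (at a)" and E0: "E 0 = 0"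
    and E': "taylor3 E' 0 A B G"
  shows "\<forall>s\<ge>0. (C has_real_derivative right_deriv C s) (at_right s)"
    and "(C has_real_derivative A * D / 2) (at_right 0)"
    and "B = 0 \<Longrightarrow> ((\<lambda>s. (right_deriv C s - right_deriv C 0) / s) \<longlongrightarrow> D / 2 * (G * D - 2 * v * A)) (at_right 0)"
    and "B > 0 \<Longrightarrow> filterlim (\<lambda>s. (right_deriv C s - right_deriv C 0) / s) at_top (at_right 0)"
proof -
  define w where "w s = 1 + v * s" for s
  define a where "a s = sqrt (D * (s / w s))" for s
  define c where "c s = E' (a s) * (D / (w s)\<^sup>2 / (2 * a s))" for s
  have w: "w s \<ge> 1" if "s > 0" for s using that v by (simp add: w_def)
  have apos: "a s > 0" if "s > 0" for s
    using that D w[OF that] by (simp add: a_def)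
  have a2: "(a s)\<^sup>2 = D * (s / w s)" if "s > 0" for s
    using that D w[OF that] by (simp add: a_def)
  have dC: "(C has_real_derivative c s) (at s)" if "s > 0" for s
  proof -
    have "((\<lambda>s. D * (s / w s)) has_real_derivative D / (w s)\<^sup>2) (at s)"
      unfolding w_def using w[OF that]
      by (auto intro!: derivative_eq_intros simp: w_def divide_simps power2_eq_square algebra_simps)
    moreover have "D * (s / w s) > 0" using that D w[OF that] by simp
    ultimately have "(a has_real_derivative inverse (a s) / 2 * (D / (w s)\<^sup>2)) (at s)"
      unfolding a_def by (intro DERIV_chain2[OF DERIV_real_sqrt])
    then have "((\<lambda>s. E (a s)) has_real_derivative E' (a s) * (inverse (a s) / 2 * (D / (w s)\<^sup>2))) (at s)"
      by (rule DERIV_chain2[OF E])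
    then have "((\<lambda>s. E (a s)) has_real_derivative c s) (at s)"
      by (simp add: c_def field_simps)
    then show ?thesis
      by (rule has_field_derivative_transform_within_open[of _ _ _ "{0<..}"])
        (use that in \<open>auto simp: C a_def w_def\<close>)
  qed
  have rdC: "right_deriv C s = c s" if "s > 0" for s
    by (rule right_deriv_eqI, rule has_field_derivative_at_within, rule dC, rule that)
  obtain r where r: "\<And>x. x > 0 \<Longrightarrow> E' x = A * x + B * x\<^sup>2 + G * x ^ 3 + x ^ 3 * r x"
    and rlim: "(r \<longlongrightarrow> 0) (at_right 0)"
    using E' unfolding taylor3_def by auto
  have c_eq: "c s = D / 2 / (w s)\<^sup>2 * (A + B * a s + (G + r (a s)) * (D * (s / w s)))" if "s > 0" for s
  proof -
    have eq: "A * a s + B * (a s)\<^sup>2 + G * a s ^ 3 + a s ^ 3 * r (a s) =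
        2 * a s * ((A + B * a s + (G + r (a s)) * (a s)\<^sup>2) / 2)"
      by (simp add: algebra_simps power2_eq_square power3_eq_cube)
    have key: "2 * x * (y / 2) * (D / W / (2 * x)) = D / 2 / W * y" if "x > 0" for x y W
      using that by (simp add: mult_ac)
    show ?thesis
      unfolding c_def r[OF apos[OF that]] a2[OF that, symmetric] eq by (rule key[OF apos[OF that]])
  qed
  have wlim: "(w \<longlongrightarrow> 1) (at_right 0)"
    unfolding w_def by (auto intro!: tendsto_eq_intros)
  have alim: "(a \<longlongrightarrow> 0) (at_right 0)"
    unfolding a_def using wlim by (auto intro!: tendsto_eq_intros)
  have pos: "eventually (\<lambda>s. s > 0) (at_right (0 :: real))"
    by (rule eventually_at_right_less)
  have "filterlim a (at_right 0) (at_right 0)"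
    unfolding filterlim_at
  proof
    show "eventually (\<lambda>s. a s \<in> {0<..} \<and> a s \<noteq> 0) (at_right 0)"
      by (rule eventually_mono[OF pos]) (use apos in force)
  qed (rule alim)
  from filterlim_compose[OF rlim this] have ralim: "((\<lambda>s. r (a s)) \<longlongrightarrow> 0) (at_right 0)" .
  have "((\<lambda>s. D / 2 / (w s)\<^sup>2 * (A + B * a s + (G + r (a s)) * (D * (s / w s)))) \<longlongrightarrow> A * D / 2) (at_right 0)"
    by (rule tendsto_eq_intros wlim alim ralim refl | simp)+
  then have clim: "(c \<longlongrightarrow> A * D / 2) (at_right 0)"
    by (rule Lim_transform_eventually) (rule eventually_mono[OF pos], simp only: c_eq)
  have C0: "C 0 = 0" using C[of 0] E0 by simp
  have Clim: "(C \<longlongrightarrow> 0) (at_right 0)"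
  proof -
    have "((\<lambda>s. E (a s)) \<longlongrightarrow> E 0) (at_right 0)"
      by (rule isCont_tendsto_compose[OF DERIV_isCont[OF E] alim])
    then show ?thesis
      unfolding E0
      by (rule Lim_transform_eventually) (rule eventually_mono[OF pos], simp add: C a_def w_def)
  qed
  \<comment> \<open>The chain rule fails at 0, where \<open>a\<close> is not differentiable;
    l'Hopital's rule recovers the derivative there from those at positive \<open>s\<close>.\<close>
  have "((\<lambda>s. C s / s) \<longlongrightarrow> A * D / 2) (at_right 0)"
  proof (rule lhopital_right_0[OF Clim])
    show "eventually (\<lambda>s. DERIV C s :> c s) (at_right 0)"
      using pos by eventually_elim (rule dC)
    show "((\<lambda>s. c s / 1) \<longlongrightarrow> A * D / 2) (at_right 0)"
      using clim by simp
  qed (simp_all add: eventually_mono[OF pos])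
  then show dC0: "(C has_real_derivative A * D / 2) (at_right 0)"
    by (simp add: has_field_derivative_iff C0)
  then have rdC0: "right_deriv C 0 = A * D / 2"
    by (rule right_deriv_eqI)
  show "\<forall>s\<ge>0. (C has_real_derivative right_deriv C s) (at_right s)"
  proof (intro allI impI)
    fix s :: real assume "s \<ge> 0"
    then consider "s = 0" | "s > 0" by linarith
    then show "(C has_real_derivative right_deriv C s) (at_right s)"
    proof cases
      case 1
      then show ?thesis using dC0 by (simp only: rdC0)
    next
      case 2
      then show ?thesis
        using has_field_derivative_at_within[OF dC[OF 2]] by (simp only: rdC)
    qed
  qed
  \<comment> \<open>The convergent part of the difference quotient, obtained from
    \<open>1 / w^2 - 1 = - s * (2 * v + v^2 * s) / w^2\<close>; only the \<open>B\<close> term is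
    left out.\<close>
  define q where "q s = D / 2 * (- (2 * v + v\<^sup>2 * s) * A / (w s)\<^sup>2 + (G + r (a s)) * D / (w s) ^ 3)" for s
  have q_eq: "q s + D / 2 / (w s)\<^sup>2 * B * (a s / s) = (right_deriv C s - right_deriv C 0) / s" if "s > 0" for s
  proof -
    have "A / (w s)\<^sup>2 - A = - s * (2 * v + v\<^sup>2 * s) * A / (w s)\<^sup>2"
      using w[OF that] by (simp add: field_simps) (simp add: w_def power2_eq_square algebra_simps)
    moreover have "c s - A * D / 2 = D / 2 * ((A / (w s)\<^sup>2 - A) + B * a s / (w s)\<^sup>2 + (G + r (a s)) * (D * s) / (w s) ^ 3)"
      unfolding c_eq[OF that] using w[OF that]
      by (simp add: field_simps power2_eq_square power3_eq_cube)
    ultimately have "c s - A * D / 2 = s * (q s + D / 2 / (w s)\<^sup>2 * B * (a s / s))"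
      using that by (simp add: q_def field_simps)
    then show ?thesis
      using that by (simp add: rdC rdC0)
  qed
  have qlim: "(q \<longlongrightarrow> D / 2 * (G * D - 2 * v * A)) (at_right 0)"
    unfolding q_def by (rule tendsto_eq_intros wlim ralim refl | simp)+
  show "((\<lambda>s. (right_deriv C s - right_deriv C 0) / s) \<longlongrightarrow> D / 2 * (G * D - 2 * v * A)) (at_right 0)" if "B = 0"
    by (rule Lim_transform_eventually[OF qlim], rule eventually_mono[OF pos])
       (use q_eq that in simp)
  show "filterlim (\<lambda>s. (right_deriv C s - right_deriv C 0) / s) at_top (at_right 0)" if "B > 0"
  proof -
    \<comment> \<open>The quotient \<open>a s / s\<close> grows like
      \<open>sqrt (D / s)\<close>.\<close>
    have "filterlim (\<lambda>s. sqrt (D * (s / (1 + v * s))) / s) at_top (at_right 0)"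
      using D by real_asymp
    then have a_top: "filterlim (\<lambda>s. a s / s) at_top (at_right 0)"
      by (simp add: a_def w_def)
    have "((\<lambda>s. D / 2 / (w s)\<^sup>2 * B) \<longlongrightarrow> D / 2 * B) (at_right 0)"
      by (rule tendsto_eq_intros wlim refl | simp)+
    then have "filterlim (\<lambda>s. D / 2 / (w s)\<^sup>2 * B * (a s / s)) at_top (at_right 0)"
      by (rule filterlim_tendsto_pos_mult_at_top[OF _ _ a_top]) (use D that in simp)
    then have "filterlim (\<lambda>s. q s + D / 2 / (w s)\<^sup>2 * B * (a s / s)) at_top (at_right 0)"
      by (rule filterlim_tendsto_add_at_top[OF qlim])
    then show ?thesis
      by (rule filterlim_mono_eventually[OF _ order_refl order_refl], intro eventually_mono[OF pos] q_eq)
  qed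
qed

lemma psk_capacity_eq_entropy:
  assumes "M \<ge> 2" "d \<noteq> 0" "N0 > 0" "s \<ge> 0"
  shows "psk_capacity M d g N0 s = psk_entropy M (sqrt ((cmod d)\<^sup>2 * (s / (1 + g\<^sup>2 * s))))"
  unfolding psk_capacity_def psk_entropy_def real_sqrt_mult
  using assms by (simp add: transition_prob_eq_wedge_prob)

text \<open>In the slope a common factor \<open>D^2 / 2\<close> cancels, so \<open>d\<close> and
  \<open>g\<close> survive only through the Rician factor. The sign condition on \<open>B\<close>
  excludes a second derivative of minus infinity.\<close>

lemma psk_low_snr:
  fixes d :: complex and g N0 A B G :: real
  assumes M: "M \<ge> 2" and d: "d \<noteq> 0" and g: "g\<^sup>2 > 0" and N0: "N0 > 0"
    and taylor: "taylor3 (psk_entropy' M) 0 A B G" and A: "A > 0" and B: "B \<ge> 0"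
  shows "\<forall>s\<ge>0. (psk_capacity M d g N0 has_real_derivative right_deriv (psk_capacity M d g N0) s) (at_right s)"
    and "((\<lambda>s. ereal ((right_deriv (psk_capacity M d g N0) s - right_deriv (psk_capacity M d g N0) 0) / s))
      \<longlongrightarrow> right_deriv2 (psk_capacity M d g N0) 0) (at_right 0)"
    and "(received_bit_energy M d g N0 \<longlongrightarrow> received_bit_energy_at_zero M d g N0) (at_right 0)"
    and "received_bit_energy_at_zero M d g N0 = (1 + 1 / rician_factor d g) * ln 2 / (A / 2)"
    and "wideband_slope M d g N0 = (if B > 0 then 0 else A\<^sup>2 / (2 * A / rician_factor d g - G))"
proof -
  let ?C = "psk_capacity M d g N0"
  define D where "D = (cmod d)\<^sup>2"
  define L where "L = (if B > 0 then \<infinity> else ereal (D / 2 * (G * D - 2 * g\<^sup>2 * A)))"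
  have D: "D > 0" using d by (simp add: D_def)
  have M0: "M > 0" using M by simp
  note derivs = right_derivs_sqrt_reparam[OF D less_imp_le[OF g] _ DERIV_psk_entropy[OF M0]
      psk_entropy_0[OF M0] taylor, of ?C, unfolded D_def, OF psk_capacity_eq_entropy[OF M d N0]]
  show "\<forall>s\<ge>0. (?C has_real_derivative right_deriv ?C s) (at_right s)"
    by (rule derivs(1))
  have C1: "right_deriv ?C 0 = A * D / 2"
    unfolding D_def by (intro right_deriv_eqI derivs(2))
  have lim2: "((\<lambda>s. ereal ((right_deriv ?C s - right_deriv ?C 0) / s)) \<longlongrightarrow> L) (at_right 0)"
  proof (cases "B > 0")
    case True
    then show ?thesis
      using derivs(4) by (simp add: L_def tendsto_PInfty_eq_at_top)
  next
    case False
    then show ?thesis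
      using derivs(3) B by (simp add: L_def D_def)
  qed
  then have C2: "right_deriv2 ?C 0 = L"
    unfolding right_deriv2_def by (intro tendsto_Lim) simp_all
  show "((\<lambda>s. ereal ((right_deriv ?C s - right_deriv ?C 0) / s)) \<longlongrightarrow> right_deriv2 ?C 0) (at_right 0)"
    using lim2 by (simp add: C2)
  have C0: "?C 0 = 0"
    using psk_capacity_eq_entropy[OF M d N0, of 0 g] psk_entropy_0[OF M0] by simp
  have "((\<lambda>s. ?C s / s) \<longlongrightarrow> A * D / 2) (at_right 0)"
    using derivs(2) by (simp add: has_field_derivative_iff C0 D_def)
  from tendsto_divide[OF tendsto_const this]
  have "((\<lambda>s. (D + g\<^sup>2) * ln 2 / (?C s / s)) \<longlongrightarrow> (D + g\<^sup>2) * ln 2 / (A * D / 2)) (at_right 0)"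
    using A D by simp
  then show "(received_bit_energy M d g N0 \<longlongrightarrow> received_bit_energy_at_zero M d g N0) (at_right 0)"
    unfolding received_bit_energy_at_zero_def C1 D_def[symmetric]
    by (rule Lim_transform_eventually) (simp add: received_bit_energy_def D_def)
  have K: "rician_factor d g = D / g\<^sup>2"
    by (simp add: rician_factor_def D_def)
  show "received_bit_energy_at_zero M d g N0 = (1 + 1 / rician_factor d g) * ln 2 / (A / 2)"
    using A D g by (simp add: received_bit_energy_at_zero_def C1 K D_def[symmetric] field_simps)
  have "2 * (A * D / 2)\<^sup>2 / - (D / 2 * (G * D - 2 * g\<^sup>2 * A)) = A\<^sup>2 / (2 * A / (D / g\<^sup>2) - G)"
  proof -
    have "- (D / 2 * (G * D - 2 * g\<^sup>2 * A)) = D\<^sup>2 / 2 * (2 * A / (D / g\<^sup>2) - G)"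
      using D by (simp add: field_simps power2_eq_square)
    moreover have "2 * (A * D / 2)\<^sup>2 = D\<^sup>2 / 2 * A\<^sup>2"
      by (simp add: power2_eq_square)
    ultimately have "2 * (A * D / 2)\<^sup>2 / - (D / 2 * (G * D - 2 * g\<^sup>2 * A)) =
        D\<^sup>2 / 2 * A\<^sup>2 / (D\<^sup>2 / 2 * (2 * A / (D / g\<^sup>2) - G))"
      by (simp only:)
    also have "\<dots> = A\<^sup>2 / (2 * A / (D / g\<^sup>2) - G)"
      using D by (intro mult_divide_mult_cancel_left) simp
    finally show ?thesis .
  qed
  then show "wideband_slope M d g N0 = (if B > 0 then 0 else A\<^sup>2 / (2 * A / rician_factor d g - G))"
    by (simp add: wideband_slope_def C1 C2 L_def K Let_def)
qed

section \<open>The coefficients for each constellation size\<close>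

lemma sin_multiple_pi_div_pos:
  assumes "0 < j" "j < M"
  shows "sin (pi * real j / real M) > 0"
  using assms by (intro sin_gt_zero) (auto simp: field_simps)

text \<open>Here \<open>X 2\<close> and \<open>X 4\<close> survive. The term \<open>X 2\<close>
  doubles the linear coefficient against the generic formula, which explains the separate bit energy
  for \<open>M = 2\<close>.\<close>

lemma taylor3_psk_entropy'_2: "taylor3 (psk_entropy' 2) 0 (4 / pi) 0 (16 / (3 * pi\<^sup>2) - 16 / (3 * pi))"
proof -
  define X where "X j = (\<Sum>l<(2::nat). cos (real j * (2 * pi * real l / real 2)))" for j
  have s3: "sin (3 * (pi / 2)) = - 1" "sin (pi * 3 / 2) = - 1"
    using sin_3over2_pi by (simp_all add: mult.commute)
  have "X 1 = 0" "X 3 = 0"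
    unfolding X_def by (rule sum_cos_multiples_eq_0; simp add: s3)+
  moreover have "X 2 = 2" "X 4 = 2"
    unfolding X_def by (subst sum_cos_multiples_eq_M; simp)+
  ultimately show ?thesis
    using psk_entropy_coeffs[of 2, folded X_def] s3
    by (simp add: field_simps power2_eq_square)
qed

text \<open>Of the sums entering the quadratic coefficient, \<open>X 3\<close> survives, and only
  for this size. A positive \<open>B\<close> already makes the second derivative infinite, so
  \<open>G\<close> is left unspecified.\<close>

lemma taylor3_psk_entropy'_3: "\<exists>B G. B > 0 \<and> taylor3 (psk_entropy' 3) 0 (27 / (8 * pi)) B G"
proof -
  define X where "X j = (\<Sum>l<(3::nat). cos (real j * (2 * pi * real l / real 3)))" for j
  have X: "X 1 = 0" "X 2 = 0" "X 3 = 3"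
    unfolding X_def
    using sin_multiple_pi_div_pos[of 1 3] sin_multiple_pi_div_pos[of 2 3]
    by (intro sum_cos_multiples_eq_0; simp)+ (subst sum_cos_multiples_eq_M; simp)
  have S: "sin (pi / 3) = sqrt 3 / 2" "sin (2 * (pi / 3)) = sqrt 3 / 2"
    unfolding sin_double by (simp_all add: sin_60 cos_60)
  have r: "(sqrt 3 / 2)\<^sup>2 = 3 / 4" "sqrt 3 / 2 * (sqrt 3 / 2) = 3 / 4" "(sqrt 3 / 2) ^ 3 = 3 / 8 * sqrt 3"
    by (simp_all add: power_divide power3_eq_cube)
  have "\<exists>G. taylor3 (psk_entropy' 3) 0 (27 / (8 * pi)) (1 / (pi * sqrt pi) * (81 / 16 - 81 / 64 * sqrt 3)) G"
    by (rule exI, rule taylor3_cong[OF psk_entropy_coeffs[of 3, folded X_def]])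
       (simp_all only: of_nat_numeral X S r, simp_all add: field_simps)
  moreover have "sqrt 3 < 2" by (rule real_less_lsqrt) simp_all
  then have "1 / (pi * sqrt pi) * (81 / 16 - 81 / 64 * sqrt 3) > 0"
    by (intro mult_pos_pos) simp_all
  ultimately show ?thesis by blast
qed

text \<open>Only \<open>X 4\<close> survives; it occurs in the cubic coefficient alone, so the bit
  energy is generic while the slope is not.\<close>

lemma taylor3_psk_entropy'_4: "taylor3 (psk_entropy' 4) 0 (4 / pi) 0 (8 / (3 * pi\<^sup>2) - 8 / (3 * pi))"
proof -
  define X where "X j = (\<Sum>l<(4::nat). cos (real j * (2 * pi * real l / real 4)))" for j
  have X: "X 1 = 0" "X 2 = 0" "X 3 = 0" "X 4 = 4"
    unfolding X_def
    using sin_multiple_pi_div_pos[of 1 4] sin_multiple_pi_div_pos[of 2 4] sin_multiple_pi_div_pos[of 3 4]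
    by (intro sum_cos_multiples_eq_0; simp)+ (subst sum_cos_multiples_eq_M; simp)
  have S: "sin (pi / 4) = sqrt 2 / 2" "sin (3 * (pi / 4)) = sqrt 2 / 2" "sin (2 * (pi / 4)) = 1"
    using sin_pi_minus[of "pi / 4"] by (simp_all add: sin_45 field_simps)
  have r: "(sqrt 2 / 2)\<^sup>2 = 1 / 2" "(sqrt 2 / 2) ^ 4 = 1 / 4"
    by (simp_all add: power_divide power4_eq_xxxx)
  show ?thesis
    by (rule taylor3_cong[OF psk_entropy_coeffs[of 4, folded X_def]])
       (simp_all only: of_nat_numeral X S r, simp_all add: field_simps power2_eq_square)
qed

lemma taylor3_psk_entropy'_ge_5:
  assumes M: "M \<ge> 5"
  shows "taylor3 (psk_entropy' M) 0 ((real M)\<^sup>2 * (sin (pi / M))\<^sup>2 / (2 * pi)) 0 (2 * psi M)"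
proof -
  define X where "X j = (\<Sum>l<M. cos (real j * (2 * pi * real l / real M)))" for j
  define S S2 where "S = sin (pi / M)" and "S2 = sin (2 * (pi / M))"
  have "X j = 0" if "0 < j" "j < 5" for j
    unfolding X_def using that M sin_multiple_pi_div_pos[of j M] by (intro sum_cos_multiples_eq_0) auto
  then have X: "X 1 = 0" "X 2 = 0" "X 3 = 0" "X 4 = 0"
    by auto
  \<comment> \<open>Needed to match \<open>psi\<close>, which contains \<open>- 4 * pi * S^2\<close>
    in the form \<open>- pi * S2^2 - 4 * pi * S^4\<close>.\<close>
  have S2: "S2\<^sup>2 = 4 * S\<^sup>2 - 4 * S ^ 4"
  proof -
    have "S2\<^sup>2 = 4 * S\<^sup>2 * (cos (pi / M))\<^sup>2"
      unfolding S2_def S_def sin_double by (simp add: power_mult_distrib)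
    also have "(cos (pi / M))\<^sup>2 = 1 - S\<^sup>2"
      by (simp add: S_def cos_squared_eq)
    finally show ?thesis by algebra
  qed
  have "- (real M * S / (3 * pi)) * (3 * S * (real M / 2)) + real M / 2 * (S2\<^sup>2 / pi\<^sup>2) * (real M / 2)
      - (real M)\<^sup>2 * (S\<^sup>2 * S2 / pi\<^sup>2) * (real M / 4) + real M ^ 3 / 3 * (S ^ 4 / pi\<^sup>2) * (3 * real M / 8)
    = (real M)\<^sup>2 / (8 * pi\<^sup>2) * (2 * S2\<^sup>2 - 4 * pi * S\<^sup>2 + (real M)\<^sup>2 * S ^ 4 - 2 * real M * S\<^sup>2 * S2)"
    by (simp add: field_simps power2_eq_square power3_eq_cube power4_eq_xxxx)
  also have "2 * S2\<^sup>2 - 4 * pi * S\<^sup>2 + (real M)\<^sup>2 * S ^ 4 - 2 * real M * S\<^sup>2 * S2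
     = (2 - pi) * S2\<^sup>2 + ((real M)\<^sup>2 - 4 * pi) * S ^ 4 - 2 * real M * S\<^sup>2 * S2"
    unfolding left_diff_distrib S2 by (simp add: algebra_simps)
  also have "(real M)\<^sup>2 / (8 * pi\<^sup>2) * \<dots> = 2 * psi M"
    by (simp add: psi_def S_def S2_def)
  finally have G: "- (real M * S / (3 * pi)) * (3 * S * (real M / 2)) + real M / 2 * (S2\<^sup>2 / pi\<^sup>2) * (real M / 2)
      - (real M)\<^sup>2 * (S\<^sup>2 * S2 / pi\<^sup>2) * (real M / 4) + real M ^ 3 / 3 * (S ^ 4 / pi\<^sup>2) * (3 * real M / 8) = 2 * psi M" .
  have "M > 0" using M by simp
  from psk_entropy_coeffs[OF this, folded X_def S_def S2_def, unfolded X]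
  show ?thesis
    by (rule taylor3_cong)
       (use G in \<open>simp_all add: S_def[symmetric] power2_eq_square mult_ac\<close>)
qed

text \<open>Since \<open>right_deriv\<close> and \<open>right_deriv2\<close> are defined by
  \<open>Lim\<close>, which is arbitrary without convergence, the first two conjuncts certify that
  the derivatives exist; the third identifies the bit energy formula with the actual limit.\<close>

theorem corollary5:
  fixes M :: nat and d :: complex and g N0 K :: real
  assumes "M \<ge> 2" and "d \<noteq> 0" and "g\<^sup>2 > 0" and "N0 > 0"
    and "K = rician_factor d g"
  shows
    "(\<forall>s\<ge>0. (psk_capacity M d g N0 has_real_derivative right_deriv (psk_capacity M d g N0) s) (at_right s))
     \<and> ((\<lambda>s. ereal ((right_deriv (psk_capacity M d g N0) s - right_deriv (psk_capacity M d g N0) 0) / s))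
          \<longlongrightarrow> right_deriv2 (psk_capacity M d g N0) 0) (at_right 0)
     \<and> (received_bit_energy M d g N0 \<longlongrightarrow> received_bit_energy_at_zero M d g N0) (at_right 0)
     \<and> received_bit_energy_at_zero M d g N0 =
         (if M = 2 then pi / 2 * (1 + 1 / K) * ln 2
          else 4 * pi / ((real M)\<^sup>2 * (sin (pi / real M))\<^sup>2) * (1 + 1 / K) * ln 2)
     \<and> wideband_slope M d g N0 =
         (if M = 2 then 3 / (pi - 1 + 3 * pi / (2 * K))
          else if M = 3 then 0
          else if M = 4 then 6 / (pi - 1 + 3 * pi / K)
          else ((real M) ^ 4 / (8 * pi\<^sup>2) * sin (pi / real M) ^ 4)
                 / (- psi M + 1 / (2 * pi * K) * (real M)\<^sup>2 * (sin (pi / real M))\<^sup>2))"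
proof -
  note low_snr = psk_low_snr[OF assms(1-4), folded assms(5)]
  consider "M = 2" | "M = 3" | "M = 4" | "M \<ge> 5" using assms(1) by linarith
  then show ?thesis
  proof cases
    case 1
    have A: "4 / pi > 0" by simp
    note t = low_snr[unfolded 1, OF taylor3_psk_entropy'_2 A order_refl]
    have energy: "(1 + 1 / K) * ln 2 / (4 / pi / 2) = pi / 2 * (1 + 1 / K) * ln 2"
      by simp
    \<comment> \<open>Numerator and denominator are matched separately and only the nonzero constant
      is cancelled, so no knowledge of whether the denominator vanishes is used.\<close>
    have "(4 / pi)\<^sup>2 / (2 * (4 / pi) / K - (16 / (3 * pi\<^sup>2) - 16 / (3 * pi))) =
        (16 / (3 * pi\<^sup>2)) * 3 / ((16 / (3 * pi\<^sup>2)) * (pi - 1 + 3 * pi / (2 * K)))"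
      by (rule arg_cong2[of _ _ _ _ "(/)"]) (simp_all add: ring_distribs power2_eq_square)
    also have "\<dots> = 3 / (pi - 1 + 3 * pi / (2 * K))"
      by (intro mult_divide_mult_cancel_left) simp
    finally have slope: "(4 / pi)\<^sup>2 / (2 * (4 / pi) / K - (16 / (3 * pi\<^sup>2) - 16 / (3 * pi))) =
        3 / (pi - 1 + 3 * pi / (2 * K))" .
    show ?thesis
      unfolding 1 by (intro conjI t(1-3)) (simp_all only: t(4,5) energy slope if_True if_False less_irrefl simp_thms)
  next
    case 2
    obtain B G where B: "B > 0" and BG: "taylor3 (psk_entropy' 3) 0 (27 / (8 * pi)) B G"
      using taylor3_psk_entropy'_3 by blast
    have A: "27 / (8 * pi) > 0" by simp
    note t = low_snr[unfolded 2, OF BG A less_imp_le[OF B]]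
    have energy: "(1 + 1 / K) * ln 2 / (27 / (8 * pi) / 2) =
        4 * pi / ((real 3)\<^sup>2 * (sin (pi / real 3))\<^sup>2) * (1 + 1 / K) * ln 2"
      by (simp add: sin_60 power_divide)
    have ineqs: "(3 :: nat) = 2 \<longleftrightarrow> False" by simp
    show ?thesis
      unfolding 2 by (intro conjI t(1-3)) (simp_all only: t(4,5) energy B ineqs if_True if_False simp_thms)
  next
    case 3
    have A: "4 / pi > 0" by simp
    note t = low_snr[unfolded 3, OF taylor3_psk_entropy'_4 A order_refl]
    have energy: "(1 + 1 / K) * ln 2 / (4 / pi / 2) =
        4 * pi / ((real 4)\<^sup>2 * (sin (pi / real 4))\<^sup>2) * (1 + 1 / K) * ln 2"
      by (simp add: sin_45 power_divide)
    have "(4 / pi)\<^sup>2 / (2 * (4 / pi) / K - (8 / (3 * pi\<^sup>2) - 8 / (3 * pi))) =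
        (8 / (3 * pi\<^sup>2)) * 6 / ((8 / (3 * pi\<^sup>2)) * (pi - 1 + 3 * pi / K))"
      by (rule arg_cong2[of _ _ _ _ "(/)"]) (simp_all add: ring_distribs power2_eq_square)
    also have "\<dots> = 6 / (pi - 1 + 3 * pi / K)"
      by (intro mult_divide_mult_cancel_left) simp
    finally have slope: "(4 / pi)\<^sup>2 / (2 * (4 / pi) / K - (8 / (3 * pi\<^sup>2) - 8 / (3 * pi))) =
        6 / (pi - 1 + 3 * pi / K)" .
    have ineqs: "(4 :: nat) = 2 \<longleftrightarrow> False" "(4 :: nat) = 3 \<longleftrightarrow> False" by simp_all
    show ?thesis
      unfolding 3 by (intro conjI t(1-3)) (simp_all only: t(4,5) energy slope ineqs if_True if_False less_irrefl simp_thms)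
  next
    case 4
    define S where "S = sin (pi / M)"
    have "S > 0"
      using sin_multiple_pi_div_pos[of 1 M] 4 by (simp add: S_def)
    define A where "A = (real M)\<^sup>2 * S\<^sup>2 / (2 * pi)"
    have A: "A > 0" using 4 \<open>S > 0\<close> by (simp add: A_def)
    note t = low_snr[OF taylor3_psk_entropy'_ge_5[OF 4, folded S_def, folded A_def] A order_refl]
    have "A\<^sup>2 / (2 * A / K - 2 * psi M) = 2 * ((real M) ^ 4 / (8 * pi\<^sup>2) * S ^ 4) /
        (2 * (- psi M + 1 / (2 * pi * K) * (real M)\<^sup>2 * S\<^sup>2))"
      by (rule arg_cong2[of _ _ _ _ "(/)"])
         (simp_all add: A_def power2_eq_square power4_eq_xxxx)
    then have slope: "A\<^sup>2 / (2 * A / K - 2 * psi M) = ((real M) ^ 4 / (8 * pi\<^sup>2) * S ^ 4) /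
        (- psi M + 1 / (2 * pi * K) * (real M)\<^sup>2 * S\<^sup>2)"
      by (simp only: mult_divide_mult_cancel_left_if) simp
    have energy: "(1 + 1 / K) * ln 2 / (A / 2) = 4 * pi / ((real M)\<^sup>2 * S\<^sup>2) * (1 + 1 / K) * ln 2"
      by (simp add: A_def)
    have ineqs: "M = 2 \<longleftrightarrow> False" "M = 3 \<longleftrightarrow> False" "M = 4 \<longleftrightarrow> False" using 4 by auto
    show ?thesis
      unfolding S_def[symmetric] by (intro conjI t(1-3)) (simp_all only: t(4,5) energy slope ineqs if_True if_False less_irrefl simp_thms)
  qed
qed

end
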